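(* Consider the RIS-aided MIMO channel $\mathbf G=\sqrt{\beta_{\mathrm t}\beta_{\mathrm r}}\mathbf R\boldsymbol\Phi\mathbf T+\sqrt{\beta_{\mathrm d}}\mathbf H$ described in the context, with $N_{\mathrm r}\ge N_{\mathrm t}$, and let $C=\mathbb E\{\log_2\det(\mathbf I_{N_{\mathrm r}}+\bar\rho\,\mathbf G\mathbf G^{\dagger})\}$ with $\bar\rho=\rho/N_{\mathrm t}$, $\rho>0$. Then $$C\le\log_2\Big(\sum_{t=0}^{N_{\mathrm t}}\bar\rho^{\,t}\sum_{\mathcal Q\subseteq\{1,\dots,N_{\mathrm t}\},\,|\mathcal Q|=t}\det(\boldsymbol\Psi_{\mathcal Q})\,\mathsf J_{N_{\mathrm r}}\big(\tilde\theta_1,\dots,\tilde\theta_{L_{\mathcal Q}}\big)\frac{(N_{\mathrm r}-L_{\mathcal Q})!}{(N_{\mathrm r}-t)!}\Big),$$ where for each $\mathcal Q$, $\tilde\theta_1,\dots,\tilde\theta_{L_{\mathcal Q}}$ are the non-zero eigenvalues of $\boldsymbol\Psi_{\mathcal Q}^{-1}\boldsymbol\Sigma_{\mathcal Q}$ with $\boldsymbol\Sigma=\bar{\mathbf G}^{\dagger}\bar{\mathbf G}$.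
   Context: Setup: $N_{\mathrm t},N_{\mathrm r},M=M_{\mathrm h}M_{\mathrm v}$ positive integers; $\mathbf T\in\mathbb C^{M\times N_{\mathrm t}}$, $\bar{\mathbf R}\in\mathbb C^{N_{\mathrm r}\times M}$, $\bar{\mathbf H}\in\mathbb C^{N_{\mathrm r}\times N_{\mathrm t}}$ are line-of-sight matrices of the form $\mathbf T=\sum_{i=1}^{P_{\mathbf T}}\frac{t_i}{\sqrt{P_{\mathbf T}}}\mathbf a_{M_{\mathrm h},M_{\mathrm v}}(\varphi_{a_1,i},\theta_{a_1,i})\mathbf a_{N_{\mathrm t}}(\theta_{d_1,i})^\intercal$, $\bar{\mathbf R}=\sum_{i=1}^{P_{\mathbf R}}\frac{r_i}{\sqrt{P_{\mathbf R}}}\mathbf a_{N_{\mathrm r}}(\theta_{a_2,i})\mathbf a_{M_{\mathrm h},M_{\mathrm v}}(\varphi_{d_2,i},\theta_{d_2,i})^\intercal$, $\bar{\mathbf H}=\sum_{i=1}^{P_{\mathbf H}}\frac{h_i}{\sqrt{P_{\mathbf H}}}\mathbf a_{N_{\mathrm r}}(\theta_{a_3,i})\mathbf a_{N_{\mathrm t}}(\theta_{d_3,i})^\intercal$, where $\mathbf a_N(\theta)=[e^{\mathsf j2\pi(n-1)\frac{d}{\lambda}\sin\theta}]_{n=1}^{N}$ (column; $d=d_{\mathrm t}$ for $N_{\mathrm t}$, $d=d_{\mathrm r}$ for $N_{\mathrm r}$) and $\mathbf a_{M_{\mathrm h},M_{\mathrm v}}(\varphi,\theta)^\intercal=[e^{\mathsf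 j2\pi(m-1)\frac{d_{\mathrm v}}{\lambda}\sin\theta}]_{m=1}^{M_{\mathrm v}}\otimes[e^{\mathsf j2\pi(n-1)\frac{d_{\mathrm h}}{\lambda}\cos\theta\sin\varphi}]_{n=1}^{M_{\mathrm h}}$. The gains $t_i,r_i,h_i$ (i.i.d. $\mathcal{CN}(0,1)$ in the model) and all angles are treated as fixed (the result is conditional on them). $\boldsymbol\Phi=\mathrm{diag}\{e^{\mathsf j\theta_1},\dots,e^{\mathsf j\theta_M}\}$ is fixed. $\beta_{\mathrm t},\beta_{\mathrm r},\beta_{\mathrm d}>0$; $L_{\mathbf R}+N_{\mathbf R}=1$, $L_{\mathbf H}+N_{\mathbf H}=1$, all $\ge0$, and $N_{\mathbf H}>0$. $\mathbf R=\sqrt{L_{\mathbf R}}\bar{\mathbf R}+\sqrt{N_{\mathbf R}}\tilde{\mathbf R}$, $\mathbf H=\sqrt{L_{\mathbf H}}\bar{\mathbf H}+\sqrt{N_{\mathbf H}}\tilde{\mathbf H}$ with $\tilde{\mathbf R},\tilde{\mathbf H}$ independent with i.i.d. $\mathcal{CN}(0,1)$ entries; the expectation is over $\tilde{\mathbf R},\tilde{\mathbf H}$. Define $\bar{\mathbf G}=\sqrt{\beta_{\mathrm t}\beta_{\mathrm r}L_{\mathbf R}}\bar{\mathbf R}\boldsymbol\Phi\mathbf T+\sqrt{\beta_{\mathrm d}L_{\mathbf H}}\bar{\mathbf H}$ and $\boldsymbol\Psi=\beta_{\mathrm t}\beta_{\mathrm r}N_{\mathbf R}\mathbf T^{\dagger}\mathbf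 T+\beta_{\mathrm d}N_{\mathbf H}\mathbf I_{N_{\mathrm t}}$. For a square matrix $\mathbf A$ and index set $\mathcal Q$, $\mathbf A_{\mathcal Q}$ is the principal submatrix with rows and columns indexed by $\mathcal Q$ (for $\mathcal Q=\emptyset$ its determinant is $1$). For an integer $q$ and numbers $\theta_1,\dots,\theta_L$: $\mathsf J_q(\theta_1,\dots,\theta_L)=\det(\boldsymbol\Delta)/V(\theta_1,\dots,\theta_L)$, where $\boldsymbol\Delta\in\mathbb C^{L\times L}$ has $(i,j)$ entry $(q-L+j+\theta_i)\theta_i^{j-1}$ and $V(\theta_1,\dots,\theta_L)=\prod_{i<j\le L}(\theta_j-\theta_i)$; $\mathsf J_q=1$ when $L=0$, and when eigenvalues coincide the ratio is understood as its limit. *)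

theory Defs
  imports "HOL-Probability.Probability" "Jordan_Normal_Form.Jordan_Normal_Form"
begin

definition ctrans :: "complex mat \<Rightarrow> complex mat" where
  "ctrans A = mat (dim_col A) (dim_row A) (\<lambda>(i,j). cnj (A $$ (j,i)))"

text \<open>Matrix inverse (only used for invertible matrices).\<close>
definition minv :: "complex mat \<Rightarrow> complex mat" where
  "minv A = the (mat_inverse A)"

definition principal_submat :: "complex mat \<Rightarrow> nat set \<Rightarrow> complex mat" where
  "principal_submat A Q = mat (card Q) (card Q)
     (\<lambda>(i,j). A $$ (sorted_list_of_set Q ! i, sorted_list_of_set Q ! j))"

definition eigvals :: "complex mat \<Rightarrow> complex list" where
  "eigvals A = (SOME as. length as = dim_row A \<and> char_poly A = (\<Prod>a\<leftarrow>as. [:- a, 1:]))"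

definition nonzero_eigvals :: "complex mat \<Rightarrow> complex list" where
  "nonzero_eigvals A = filter (\<lambda>x. x \<noteq> 0) (eigvals A)"

definition J_raw :: "int \<Rightarrow> complex list \<Rightarrow> complex" where
  "J_raw q ths = (let L = length ths in
     det (mat L L (\<lambda>(i,j). (of_int q - of_nat L + of_nat (j+1) + ths ! i) * (ths ! i) ^ j))
     / (\<Prod>j<L. \<Prod>i<j. (ths ! j - ths ! i)))"

text \<open>J with the value at coinciding arguments understood as a limit: we take the limit
  along the perturbation th_i + s*i (s -> 0), along which the arguments are pairwise
  distinct for all small s \<noteq> 0.  For distinct arguments this is just J_raw
  (the ratio is a polynomial, hence continuous).\<close>
definition J :: "int \<Rightarrow> complex list \<Rightarrow> complex" where
  "J q ths = Lim (at (0::complex)) (\<lambda>s. J_raw q (map (\<lambda>(i,x). x + s * of_nat i) (List.enumerate 0 ths)))"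

text \<open>ULA response a_N(theta), n-th (0-based) entry exp(j 2 pi n (d/lambda) sin theta);
  dl = d/lambda.\<close>
definition ula :: "real \<Rightarrow> real \<Rightarrow> nat \<Rightarrow> complex" where
  "ula dl th n = cis (2 * pi * real n * dl * sin th)"

text \<open>UPA response a_{Mh,Mv}(phi,theta): Kronecker product (vertical) \<otimes> (horizontal),
  entry at 0-based index m*Mh + n is
  exp(j 2 pi m (dv/lambda) sin theta) * exp(j 2 pi n (dh/lambda) cos theta sin phi).\<close>
definition upa :: "nat \<Rightarrow> real \<Rightarrow> real \<Rightarrow> real \<Rightarrow> real \<Rightarrow> nat \<Rightarrow> complex" where
  "upa Mh dhl dvl ph th k =
     cis (2 * pi * real (k div Mh) * dvl * sin th) * cis (2 * pi * real (k mod Mh) * dhl * cos th * sin ph)"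

definition LoS_T :: "nat \<Rightarrow> nat \<Rightarrow> nat \<Rightarrow> real \<Rightarrow> real \<Rightarrow> real \<Rightarrow> nat \<Rightarrow> (nat \<Rightarrow> complex)
    \<Rightarrow> (nat \<Rightarrow> real) \<Rightarrow> (nat \<Rightarrow> real) \<Rightarrow> (nat \<Rightarrow> real) \<Rightarrow> complex mat" where
  "LoS_T Mh Mv Nt dhl dvl dtl P g phA thA thD = mat (Mh * Mv) Nt (\<lambda>(k,l).
     \<Sum>i<P. g i / complex_of_real (sqrt (real P)) * upa Mh dhl dvl (phA i) (thA i) k * ula dtl (thD i) l)"

definition LoS_R :: "nat \<Rightarrow> nat \<Rightarrow> nat \<Rightarrow> real \<Rightarrow> real \<Rightarrow> real \<Rightarrow> nat \<Rightarrow> (nat \<Rightarrow> complex)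
    \<Rightarrow> (nat \<Rightarrow> real) \<Rightarrow> (nat \<Rightarrow> real) \<Rightarrow> (nat \<Rightarrow> real) \<Rightarrow> complex mat" where
  "LoS_R Mh Mv Nr dhl dvl drl P g thA phD thD = mat Nr (Mh * Mv) (\<lambda>(k,l).
     \<Sum>i<P. g i / complex_of_real (sqrt (real P)) * ula drl (thA i) k * upa Mh dhl dvl (phD i) (thD i) l)"

definition LoS_H :: "nat \<Rightarrow> nat \<Rightarrow> real \<Rightarrow> real \<Rightarrow> nat \<Rightarrow> (nat \<Rightarrow> complex)
    \<Rightarrow> (nat \<Rightarrow> real) \<Rightarrow> (nat \<Rightarrow> real) \<Rightarrow> complex mat" where
  "LoS_H Nr Nt drl dtl P g thA thD = mat Nr Nt (\<lambda>(k,l).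
     \<Sum>i<P. g i / complex_of_real (sqrt (real P)) * ula drl (thA i) k * ula dtl (thD i) l)"

definition ris_phase :: "nat \<Rightarrow> (nat \<Rightarrow> real) \<Rightarrow> complex mat" where
  "ris_phase M th = mat M M (\<lambda>(i,j). if i = j then cis (th i) else 0)"

definition cgauss :: "complex measure" where
  "cgauss = density lborel (\<lambda>z. ennreal (exp (- (cmod z)\<^sup>2) / pi))"

definition cgauss_mat_measure :: "nat \<Rightarrow> nat \<Rightarrow> (nat \<times> nat \<Rightarrow> complex) measure" where
  "cgauss_mat_measure m n = PiM ({..<m} \<times> {..<n}) (\<lambda>_. cgauss)"

definition to_mat :: "nat \<Rightarrow> nat \<Rightarrow> (nat \<times> nat \<Rightarrow> complex) \<Rightarrow> complex mat" where
  "to_mat m n w = mat m n w"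

end

theory Submission
  imports Defs
begin

text \<open>
  By Jensen's inequality it suffices to compute the expectation of
  \<open>det (I + \<rho> G G\<^sup>\<dagger>) = det (I + \<rho> G\<^sup>\<dagger> G)\<close>, which is the sum over \<open>Q\<close> of
  \<open>\<rho> ^ card Q\<close> times the principal minor \<open>det ((G\<^sup>\<dagger> G)\<^sub>Q)\<close>.

  Each row of \<open>G\<^sup>\<dagger> G\<close> is a sum over the rows of \<open>G\<close>. By multilinearity the minor is a sum over
  maps \<open>f\<close> from \<open>Q\<close> to the rows of \<open>G\<close>, and only injective \<open>f\<close> survive, since otherwise two rows
  are proportional. For injective \<open>f\<close> the rows involved are independent, so the expectation may be
  taken factor by factor; this replaces \<open>cnj (G\<^bsub>r i\<^esub>) G\<^bsub>r j\<^esub>\<close> by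
  \<open>\<Psi>\<^bsub>i j\<^esub> + cnj (Gb\<^bsub>r i\<^esub>) Gb\<^bsub>r j\<^esub>\<close>. Expanding again by multilinearity and counting the injective
  extensions of a map defined on \<open>U \<subseteq> Q\<close> gives, with \<open>n\<close> the number of rows of \<open>G\<close>, the sum over
  \<open>U\<close> of \<open>(n - card U)! / (n - card Q)!\<close> times the determinant with rows of \<open>\<Sigma>\<close> on \<open>U\<close> and rows
  of \<open>\<Psi>\<close> off \<open>U\<close>. The sums of these determinants over \<open>U\<close> of a fixed size are the coefficients of
  \<open>det (\<Sigma>\<^sub>Q + y \<Psi>\<^sub>Q) = det \<Psi>\<^sub>Q \<Prod>\<^sub>i (y + \<theta>\<^sub>i)\<close>, that is, elementary symmetric functions of the
  eigenvalues. Finally, a bordered Vandermonde determinant shows that \<open>J\<close> is the same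
  factorial-weighted sum of elementary symmetric functions.
\<close>

section \<open>Determinants over finite index sets\<close>

text \<open>Leibniz formula over an arbitrary finite index set. Principal minors need no renumbering
  this way, and single rows can be exchanged by an \<open>if\<close> in the entry function.\<close>

definition idet :: "'i set \<Rightarrow> ('i \<Rightarrow> 'i \<Rightarrow> 'a::comm_ring_1) \<Rightarrow> 'a" where
  "idet S a = (\<Sum>p | p permutes S. of_int (sign p) * (\<Prod>i\<in>S. a i (p i)))"

lemma idet_cong:
  assumes "\<And>i j. i \<in> S \<Longrightarrow> j \<in> S \<Longrightarrow> a i j = b i j"
  shows "idet S a = idet S b"
  unfolding idet_def
  by (intro sum.cong refl arg_cong2[where f = "(*)"] prod.cong)
     (auto simp: assms permutes_in_image)

lemma idet_empty [simp]: "idet {} a = 1"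
  by (simp add: idet_def)

lemma det_mat_eq_idet:
  "det (mat n n (\<lambda>(i, j). a i j)) = idet {..<n} a"
proof -
  have "det (mat n n (\<lambda>(i, j). a i j)) =
    (\<Sum>p | p permutes {0..<n}. of_int (sign p) * (\<Prod>i = 0..<n. mat n n (\<lambda>(i, j). a i j) $$ (i, p i)))"
    by (rule det_def') simp
  also have "\<dots> = idet {..<n} a"
    unfolding idet_def lessThan_atLeast0
    by (intro sum.cong refl arg_cong2[where f = "(*)"] prod.cong)
       (auto simp: permutes_in_image)
  finally show ?thesis .
qed

text \<open>Conjugating a permutation by the bijection keeps its sign and only relabels the factors
  of its product. This removes the numbering of \<open>Q\<close> built into
  \<open>principal_submat\<close>.\<close>

lemma idet_reindex:
  assumes "bij_betw f A B" "finite A"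
  shows "idet A (\<lambda>i j. a (f i) (f j)) = idet B a"
proof -
  have inj: "inj_on f A" and im: "f ` A = B"
    using assms by (auto simp: bij_betw_def)
  have inv: "bij_betw (inv_into A f) B A"
    by (rule bij_betw_inv_into[OF assms(1)])
  show ?thesis
    unfolding idet_def
  proof (rule sum.reindex_bij_witness[where i = "map_permutation B (inv_into A f)"
        and j = "map_permutation A f"])
    fix p assume "p \<in> {p. p permutes A}"
    then have p: "p permutes A" by simp
    show "map_permutation A f p \<in> {p. p permutes B}"
      using map_permutation_permutes[OF assms(1) p] by simp
    show "map_permutation B (inv_into A f) (map_permutation A f p) = p"
      by (rule map_permutation_compose_inv[OF assms(1) p]) (use inj in auto)
    have "(\<Prod>i\<in>B. a i (map_permutation A f p i)) = (\<Prod>i\<in>A. a (f i) (f (p i)))"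
      unfolding im[symmetric]
      by (subst prod.reindex[OF inj]) (auto intro!: prod.cong simp: map_permutation_apply[OF inj])
    then show "of_int (sign (map_permutation A f p)) * (\<Prod>i\<in>B. a i (map_permutation A f p i)) =
      of_int (sign p) * (\<Prod>i\<in>A. a (f i) (f (p i)))"
      using sign_map_permutation[OF inj p assms(2)] by simp
  next
    fix q assume "q \<in> {p. p permutes B}"
    then have q: "q permutes B" by simp
    show "map_permutation B (inv_into A f) q \<in> {p. p permutes A}"
      using map_permutation_permutes[OF inv q] by simp
    show "map_permutation A f (map_permutation B (inv_into A f) q) = q"
      by (rule map_permutation_compose_inv[OF inv q])
         (use im in \<open>auto simp: f_inv_into_f\<close>)
  qed
qed

lemma det_principal_submat:
  assumes "finite Q"
  shows "det (principal_submat A Q) = idet Q (\<lambda>i j. A $$ (i, j))"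
proof -
  let ?f = "\<lambda>i. sorted_list_of_set Q ! i"
  have "bij_betw ?f {..<card Q} Q"
    using bij_betw_nth[of "sorted_list_of_set Q" "{..<card Q}" Q] assms by simp
  from idet_reindex[OF this, of "\<lambda>i j. A $$ (i, j)"] show ?thesis
    unfolding principal_submat_def det_mat_eq_idet by simp
qed

lemma det_eq_idet:
  assumes "A \<in> carrier_mat n n"
  shows "det A = idet {..<n} (\<lambda>i j. A $$ (i, j))"
proof -
  have "A = mat n n (\<lambda>(i, j). A $$ (i, j))"
    using assms by auto
  then show ?thesis
    using det_mat_eq_idet[of n "\<lambda>i j. A $$ (i, j)"] by simp
qed

section \<open>Multilinearity and row operations\<close>

lemma prod_if_subset:
  assumes "finite S" "U \<subseteq> S"
  shows "(\<Prod>i\<in>S. if i \<in> U then a i else b i) = (\<Prod>i\<in>U. a i) * (\<Prod>i\<in>S - U. b i)"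
proof -
  have "S \<inter> U = U" "S \<inter> - U = S - U" using assms by auto
  then show ?thesis
    using prod.If_cases[OF assms(1), of "\<lambda>i. i \<in> U" a b] by simp
qed

lemma idet_add:
  assumes "finite S"
  shows "idet S (\<lambda>i j. a i j + b i j) =
    (\<Sum>U\<in>Pow S. idet S (\<lambda>i j. if i \<in> U then a i j else b i j))"
proof -
  have *: "(\<Prod>i\<in>S. a i (p i) + b i (p i)) =
      (\<Sum>U\<in>Pow S. \<Prod>i\<in>S. if i \<in> U then a i (p i) else b i (p i))" for p
    unfolding prod_add[OF assms]
    by (intro sum.cong refl) (simp add: prod_if_subset[OF assms])
  show ?thesis
    unfolding idet_def * sum_distrib_left by (subst sum.swap) simp
qed

text \<open>Distributing the product of sums chooses one summand \<open>f i\<close> for each row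
  \<open>i\<close> in \<open>U\<close>; the other rows stay as they are.\<close>

lemma idet_sum_rows:
  assumes "finite S" "U \<subseteq> S" "finite R"
  shows "idet S (\<lambda>i j. if i \<in> U then \<Sum>x\<in>R. c x i j else b i j) =
    (\<Sum>f\<in>U \<rightarrow>\<^sub>E R. idet S (\<lambda>i j. if i \<in> U then c (f i) i j else b i j))"
proof -
  have "finite U" using assms finite_subset by auto
  have "(\<Prod>i\<in>S. if i \<in> U then \<Sum>x\<in>R. c x i (p i) else b i (p i)) =
    (\<Sum>f\<in>U \<rightarrow>\<^sub>E R. \<Prod>i\<in>S. if i \<in> U then c (f i) i (p i) else b i (p i))" for p
    using assms by (simp add: prod_if_subset prod_sum_PiE[OF \<open>finite U\<close>] sum_distrib_right)
  then show ?thesis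
    unfolding idet_def sum_distrib_left by (subst sum.swap) (simp add: sum_distrib_left)
qed

lemma idet_row_scale:
  "idet S (\<lambda>i j. c i * a i j) = (\<Prod>i\<in>S. c i) * idet S a"
  unfolding idet_def by (simp add: prod.distrib sum_distrib_left mult_ac)

lemma idet_transpose:
  assumes "finite S"
  shows "idet S (\<lambda>i j. a j i) = idet S a"
  unfolding idet_def
proof (rule sum.reindex_bij_witness[where i = Hilbert_Choice.inv and j = Hilbert_Choice.inv])
  fix p assume "p \<in> {p. p permutes S}"
  then have p: "p permutes S" by simp
  show "Hilbert_Choice.inv (Hilbert_Choice.inv p) = p" using permutes_inv_inv[OF p] .
  show "Hilbert_Choice.inv p \<in> {p. p permutes S}" using permutes_inv[OF p] by simp
  have "sign (Hilbert_Choice.inv p) = sign p"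
    using p assms by (simp add: sign_inverse permutes_imp_permutation)
  moreover have "(\<Prod>i\<in>S. a i (Hilbert_Choice.inv p i)) = (\<Prod>i\<in>S. a (p i) i)"
    using prod.permute[OF p, of "\<lambda>i. a i (Hilbert_Choice.inv p i)"] p
    by (simp add: o_def permutes_inverses)
  ultimately show "of_int (sign (Hilbert_Choice.inv p)) * (\<Prod>i\<in>S. a i (Hilbert_Choice.inv p i)) =
      of_int (sign p) * (\<Prod>i\<in>S. a (p i) i)" by simp
qed (auto simp: permutes_inv_inv permutes_inv)

lemma idet_permute_rows:
  assumes "finite S" "p permutes S"
  shows "idet S (\<lambda>i j. a (p i) j) = of_int (sign p) * idet S a"
proof -
  have "idet S a = (\<Sum>q | q permutes S. of_int (sign (q \<circ> Hilbert_Choice.inv p)) * (\<Prod>i\<in>S. a i ((q \<circ> Hilbert_Choice.inv p) i)))"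
    unfolding idet_def
    by (intro sum.reindex_bij_witness[where i = "\<lambda>q. q \<circ> Hilbert_Choice.inv p" and j = "\<lambda>q. q \<circ> p"])
       (use assms in \<open>auto simp: permutes_compose permutes_inv o_assoc[symmetric] permutes_inv_o\<close>)
  also have "\<dots> = (\<Sum>q | q permutes S. of_int (sign p) * (of_int (sign q) * (\<Prod>i\<in>S. a (p i) (q i))))"
  proof (intro sum.cong refl)
    fix q assume "q \<in> {q. q permutes S}"
    then have q: "q permutes S" by simp
    have "sign (q \<circ> Hilbert_Choice.inv p) = sign p * sign q"
      using assms q by (simp add: sign_compose sign_inverse permutes_imp_permutation permutes_inv mult.commute)
    moreover have "(\<Prod>i\<in>S. a i ((q \<circ> Hilbert_Choice.inv p) i)) = (\<Prod>i\<in>S. a (p i) (q i))"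
      using prod.permute[OF assms(2), of "\<lambda>i. a i ((q \<circ> Hilbert_Choice.inv p) i)"] assms(2)
      by (simp add: o_def permutes_inverses)
    ultimately show "of_int (sign (q \<circ> Hilbert_Choice.inv p)) * (\<Prod>i\<in>S. a i ((q \<circ> Hilbert_Choice.inv p) i)) =
      of_int (sign p) * (of_int (sign q) * (\<Prod>i\<in>S. a (p i) (q i)))"
      by (simp add: mult_ac)
  qed
  finally have "idet S a = of_int (sign p) * idet S (\<lambda>i j. a (p i) j)"
    unfolding idet_def by (simp add: sum_distrib_left)
  moreover have "of_int (sign p) * of_int (sign p) = (1 :: 'b)"
    by (simp only: of_int_mult[symmetric] sign_idempotent of_int_1)
  ultimately show ?thesis
    by (simp add: mult.assoc[symmetric])
qed

text \<open>Swapping the two equal rows changes nothing, yet negates the determinant. The type class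
  allows the resulting factor 2 to be cancelled.\<close>

lemma idet_identical_rows:
  fixes a :: "'i \<Rightarrow> 'i \<Rightarrow> 'a::{idom, ring_char_0}"
  assumes "finite S" "i \<in> S" "k \<in> S" "i \<noteq> k" "a i = a k"
  shows "idet S a = 0"
proof -
  let ?p = "Transposition.transpose i k"
  have "idet S (\<lambda>i j. a (?p i) j) = of_int (sign ?p) * idet S a"
    by (rule idet_permute_rows) (use assms in \<open>auto intro: permutes_swap_id\<close>)
  moreover have "(\<lambda>i j. a (?p i) j) = a"
    using assms by (auto simp: fun_eq_iff Transposition.transpose_def)
  ultimately have "idet S a = - idet S a"
    using assms by (simp add: sign_swap_id)
  then have "2 * idet S a = 0"
    by (simp only: mult_2 eq_neg_iff_add_eq_0)
  then show ?thesis
    by simp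
qed

text \<open>A permutation that moves a point of \<open>S - Q\<close> picks up an off-diagonal zero
  there, so only permutations of \<open>Q\<close> contribute.\<close>

lemma idet_identity_rows:
  assumes "finite S" "Q \<subseteq> S"
  shows "idet S (\<lambda>i j. if i \<in> Q then a i j else if i = j then 1 else 0) = idet Q a"
proof -
  let ?b = "\<lambda>i j. if i \<in> Q then a i j else if i = j then 1 else 0"
  have "idet Q a = (\<Sum>p | p permutes Q. of_int (sign p) * (\<Prod>i\<in>S. ?b i (p i)))"
    unfolding idet_def
  proof (intro sum.cong refl arg_cong2[where f = "(*)"])
    fix p assume "p \<in> {p. p permutes Q}"
    then show "(\<Prod>i\<in>Q. a i (p i)) = (\<Prod>i\<in>S. ?b i (p i))"
      by (intro prod.mono_neutral_cong_left) (use assms in \<open>auto simp: permutes_not_in\<close>)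
  qed
  also have "\<dots> = idet S ?b"
    unfolding idet_def
  proof (intro sum.mono_neutral_left ballI)
    show "finite {p. p permutes S}" by (rule finite_permutations) fact
    show "{p. p permutes Q} \<subseteq> {p. p permutes S}"
      using assms permutes_subset by blast
    fix p assume "p \<in> {p. p permutes S} - {p. p permutes Q}"
    then have p: "p permutes S" "\<not> p permutes Q" by auto
    have "\<exists>i\<in>S - Q. p i \<noteq> i"
      using permutes_superset[OF p(1), of Q] p(2) by metis
    then have "(\<Prod>i\<in>S. ?b i (p i)) = 0"
      using assms by (intro prod_zero) auto
    then show "of_int (sign p) * (\<Prod>i\<in>S. ?b i (p i)) = 0"
      by simp
  qed
  finally show ?thesis ..
qed

text \<open>In the multilinear expansion, \<open>Q\<close> is the set of rows taken from
  \<open>c * a\<close>; the remaining rows are unit rows and leave a principal minor.\<close>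

lemma idet_identity_plus:
  assumes "finite S"
  shows "idet S (\<lambda>i j. (if i = j then 1 else 0) + c * a i j) = (\<Sum>Q\<in>Pow S. c ^ card Q * idet Q a)"
proof -
  have "idet S (\<lambda>i j. c * a i j + (if i = j then 1 else 0)) = (\<Sum>Q\<in>Pow S. idet Q (\<lambda>i j. c * a i j))"
    unfolding idet_add[OF assms] by (intro sum.cong refl idet_identity_rows) (use assms in auto)
  then show ?thesis
    by (simp add: idet_row_scale add.commute)
qed

text \<open>Sylvester's identity: the block matrix \<open>?X\<close> equals both
  \<open>?L1 * ?R1\<close> and \<open>?L2 * ?L1\<close>. All factors are block triangular, and
  \<open>?L1\<close> has determinant 1.\<close>

lemma det_one_plus_mult_commute:
  fixes A B :: "'a::idom mat"
  assumes A: "A \<in> carrier_mat n m" and B: "B \<in> carrier_mat m n"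
  shows "det (1\<^sub>m n + A * B) = det (1\<^sub>m m + B * A)"
proof -
  let ?L1 = "four_block_mat (1\<^sub>m n) (0\<^sub>m n m) B (1\<^sub>m m)"
  let ?R1 = "four_block_mat (1\<^sub>m n) (- A) (0\<^sub>m m n) (1\<^sub>m m + B * A)"
  let ?L2 = "four_block_mat (1\<^sub>m n + A * B) (- A) (0\<^sub>m m n) (1\<^sub>m m)"
  let ?X = "four_block_mat (1\<^sub>m n) (- A) B (1\<^sub>m m)"
  have "?L1 * ?R1 = ?X"
    by (subst mult_four_block_mat[of _ n n _ m _ m _ _ n _ m])
       (use A B in auto)
  moreover have "?L2 * ?L1 = ?X"
    by (subst mult_four_block_mat[of _ n n _ m _ m _ _ n _ m])
      (use A B in \<open>auto\<close>)
  moreover have "det (?L1 * ?R1) = det ?L1 * det ?R1"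
    by (rule det_mult[of _ "n + m"]) (use A B in auto)
  moreover have "det (?L2 * ?L1) = det ?L2 * det ?L1"
    by (rule det_mult[of _ "n + m"]) (use A B in auto)
  moreover have "det ?L1 = 1"
    by (subst det_four_block_mat_upper_right_zero[of _ n _ m]) (use A B in auto)
  moreover have "det ?R1 = det (1\<^sub>m m + B * A)"
    by (subst det_four_block_mat_lower_left_zero[of _ n _ m]) (use A B in auto)
  moreover have "det ?L2 = det (1\<^sub>m n + A * B)"
    by (subst det_four_block_mat_lower_left_zero[of _ n _ m]) (use A B in auto)
  ultimately show ?thesis by simp
qed

section \<open>Gram determinants\<close>

abbreviation inj_PiE :: "'i set \<Rightarrow> 'r set \<Rightarrow> ('i \<Rightarrow> 'r) set" where
  "inj_PiE S R \<equiv> {f \<in> S \<rightarrow>\<^sub>E R. inj_on f S}"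

lemma finite_inj_PiE: "finite S \<Longrightarrow> finite R \<Longrightarrow> finite (inj_PiE S R)"
  by (rule finite_subset[OF _ finite_PiE[of S "\<lambda>_. R"]]) auto

text \<open>An injective map on \<open>S\<close> extends to \<open>x\<close> by any of the
  \<open>card R - card S\<close> values not yet taken, and \<open>G\<close> does not see which
  one.\<close>

lemma sum_inj_PiE_insert:
  fixes G :: "('i \<Rightarrow> 'r) \<Rightarrow> 'a::comm_semiring_1"
  assumes "finite S" "finite R" "x \<notin> S"
    and G: "\<And>f y. G (f(x := y)) = G f"
  shows "(\<Sum>f\<in>inj_PiE (insert x S) R. G f) = of_nat (card R - card S) * (\<Sum>f\<in>inj_PiE S R. G f)"
proof -
  have "(\<Sum>f\<in>inj_PiE (insert x S) R. G f) =
    (\<Sum>(f, y)\<in>(SIGMA f:inj_PiE S R. R - f ` S). G f)"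
  proof (rule sum.reindex_bij_witness[where j = "\<lambda>f. (f(x := undefined), f x)" and i = "\<lambda>(f, y). f(x := y)"])
    fix f assume f: "f \<in> inj_PiE (insert x S) R"
    have "f(x := undefined) \<in> S \<rightarrow>\<^sub>E R"
      using f assms(3) by (auto simp: PiE_iff extensional_def)
    moreover have "inj_on (f(x := undefined)) S" "f x \<notin> (f(x := undefined)) ` S"
      using f assms(3) by (auto simp: inj_on_def)
    ultimately show "(f(x := undefined), f x) \<in> (SIGMA f:inj_PiE S R. R - f ` S)"
      using f by auto
  next
    fix fy assume "fy \<in> (SIGMA f:inj_PiE S R. R - f ` S)"
    then obtain f y where fy: "fy = (f, y)" "f \<in> S \<rightarrow>\<^sub>E R" "inj_on f S" "y \<in> R" "y \<notin> f ` S" by auto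
    have "f x = undefined" using fy(2) assms(3) by (auto simp: PiE_iff extensional_def)
    then show "(\<lambda>f. (f(x := undefined), f x)) (case fy of (f, y) \<Rightarrow> f(x := y)) = fy"
      by (auto simp: fy(1))
    have "f(x := y) \<in> insert x S \<rightarrow>\<^sub>E R" using fy by (auto simp: PiE_iff extensional_def)
    moreover have "inj_on (f(x := y)) (insert x S)"
      using fy assms(3) by (auto simp: inj_on_def image_iff)
    ultimately show "(case fy of (f, y) \<Rightarrow> f(x := y)) \<in> inj_PiE (insert x S) R" by (auto simp: fy(1))
  qed (auto simp: G)
  also have "\<dots> = (\<Sum>f\<in>inj_PiE S R. \<Sum>y\<in>R - f ` S. G f)"
    by (subst sum.Sigma) (use assms finite_inj_PiE in auto)
  also have "\<dots> = (\<Sum>f\<in>inj_PiE S R. of_nat (card R - card S) * G f)"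
  proof (intro sum.cong refl)
    fix f assume f: "f \<in> inj_PiE S R"
    then have "card (R - f ` S) = card R - card S"
      by (subst card_Diff_subset) (use assms in \<open>auto simp: card_image\<close>)
    then show "(\<Sum>y\<in>R - f ` S. G f) = of_nat (card R - card S) * G f" by simp
  qed
  finally show ?thesis by (simp add: sum_distrib_left)
qed

text \<open>Iterating the one-point extension over \<open>D\<close> counts injective extensions by a
  falling factorial. It is written with factorials on both sides because the ring has no
  division.\<close>

lemma sum_inj_PiE_extend:
  fixes G :: "('i \<Rightarrow> 'r) \<Rightarrow> 'a::{comm_semiring_1, semiring_char_0}"
  assumes "finite U" "finite D" "finite R" "U \<inter> D = {}" "card (U \<union> D) \<le> card R"
    and G: "\<And>f x y. x \<notin> U \<Longrightarrow> G (f(x := y)) = G f"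
  shows "fact (card R - card (U \<union> D)) * (\<Sum>f\<in>inj_PiE (U \<union> D) R. G f) =
    fact (card R - card U) * (\<Sum>f\<in>inj_PiE U R. G f)"
  using assms(2,4,5)
proof (induction D rule: finite_induct)
  case (insert x D)
  let ?S = "U \<union> D" and ?n = "card R"
  have S: "finite ?S" "x \<notin> ?S" using insert assms by auto
  have c: "card (insert x ?S) = Suc (card ?S)" using S by simp
  have "(\<Sum>f\<in>inj_PiE (insert x ?S) R. G f) = of_nat (?n - card ?S) * (\<Sum>f\<in>inj_PiE ?S R. G f)"
    by (rule sum_inj_PiE_insert) (use S assms G in auto)
  moreover have "(fact (?n - card ?S) :: 'a) = of_nat (?n - card ?S) * fact (?n - card (insert x ?S))"
    using insert.prems(2) c by (subst fact_reduce) auto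
  ultimately have "fact (?n - card (insert x ?S)) * (\<Sum>f\<in>inj_PiE (insert x ?S) R. G f) =
      fact (?n - card ?S) * (\<Sum>f\<in>inj_PiE ?S R. G f)"
    by (simp add: mult_ac)
  also have "\<dots> = fact (?n - card U) * (\<Sum>f\<in>inj_PiE U R. G f)"
    by (rule insert.IH) (use insert.prems c in auto)
  finally show ?case by simp
qed simp

text \<open>After pulling the scalar \<open>u (f i) i\<close> out of each row in \<open>U\<close>,
  two rows with the same value of \<open>f\<close> become equal. Hence maps that are not injective
  on \<open>U\<close> contribute 0.\<close>

lemma idet_gram_rows:
  fixes u v :: "'r \<Rightarrow> 'i \<Rightarrow> 'a::{idom, ring_char_0}"
  assumes "finite S" "U \<subseteq> S" "finite R"
  shows "idet S (\<lambda>i j. if i \<in> U then \<Sum>r\<in>R. u r i * v r j else b i j) =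
    (\<Sum>f\<in>inj_PiE U R. idet S (\<lambda>i j. if i \<in> U then u (f i) i * v (f i) j else b i j))"
proof -
  have "idet S (\<lambda>i j. if i \<in> U then u (f i) i * v (f i) j else b i j) = 0" if "\<not> inj_on f U" for f
  proof -
    from that obtain i k where ik: "i \<in> U" "k \<in> U" "i \<noteq> k" "f i = f k"
      by (auto simp: inj_on_def)
    have "idet S (\<lambda>i j. if i \<in> U then u (f i) i * v (f i) j else b i j) =
      idet S (\<lambda>i j. (if i \<in> U then u (f i) i else 1) * (if i \<in> U then v (f i) j else b i j))"
      by (rule idet_cong) auto
    also have "\<dots> = (\<Prod>i\<in>S. if i \<in> U then u (f i) i else 1) * idet S (\<lambda>i j. if i \<in> U then v (f i) j else b i j)"
      by (rule idet_row_scale)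
    also have "idet S (\<lambda>i j. if i \<in> U then v (f i) j else b i j) = 0"
      by (rule idet_identical_rows[of _ i k]) (use ik assms in auto)
    finally show ?thesis by simp
  qed
  moreover have "finite U" using assms finite_subset by auto
  ultimately show ?thesis
    unfolding idet_sum_rows[OF assms]
    by (intro sum.mono_neutral_right) (use assms in \<open>auto intro!: finite_PiE\<close>)
qed

lemma idet_gram:
  fixes u v :: "'r \<Rightarrow> 'i \<Rightarrow> 'a::{idom, ring_char_0}"
  assumes "finite S" "finite R"
  shows "idet S (\<lambda>i j. \<Sum>r\<in>R. u r i * v r j) =
    (\<Sum>f\<in>inj_PiE S R. idet S (\<lambda>i j. u (f i) i * v (f i) j))"
proof -
  have "idet S (\<lambda>i j. \<Sum>r\<in>R. u r i * v r j) =
      idet S (\<lambda>i j. if i \<in> S then \<Sum>r\<in>R. u r i * v r j else 0)"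
    by (rule idet_cong) auto
  also have "\<dots> = (\<Sum>f\<in>inj_PiE S R. idet S (\<lambda>i j. if i \<in> S then u (f i) i * v (f i) j else 0))"
    by (rule idet_gram_rows) (use assms in auto)
  also have "\<dots> = (\<Sum>f\<in>inj_PiE S R. idet S (\<lambda>i j. u (f i) i * v (f i) j))"
    by (intro sum.cong refl idet_cong) auto
  finally show ?thesis .
qed

text \<open>Let \<open>U\<close> be the set of rows where the rank-one term is chosen. The
  determinant then depends on \<open>f\<close> only through its values on \<open>U\<close>, so the
  sum over \<open>f\<close> reduces to injections of \<open>U\<close>, and
  \<open>idet_gram_rows\<close> read backwards restores the Gram rows.\<close>

lemma sum_idet_shifted_gram:
  fixes u v :: "'r \<Rightarrow> 'i \<Rightarrow> 'a::{idom, ring_char_0}"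
  assumes "finite Q" "finite R" "card Q \<le> card R"
  shows "fact (card R - card Q) * (\<Sum>f\<in>inj_PiE Q R. idet Q (\<lambda>i j. \<psi> i j + u (f i) i * v (f i) j)) =
    (\<Sum>U\<in>Pow Q. fact (card R - card U) *
       idet Q (\<lambda>i j. if i \<in> U then \<Sum>r\<in>R. u r i * v r j else \<psi> i j))"
proof -
  define G where "G U f = idet Q (\<lambda>i j. if i \<in> U then u (f i) i * v (f i) j else \<psi> i j)" for U f
  have "(\<Sum>f\<in>inj_PiE Q R. idet Q (\<lambda>i j. \<psi> i j + u (f i) i * v (f i) j)) =
      (\<Sum>f\<in>inj_PiE Q R. \<Sum>U\<in>Pow Q. G U f)"
    unfolding G_def by (simp only: idet_add[OF assms(1), symmetric] add.commute)
  also have "\<dots> = (\<Sum>U\<in>Pow Q. \<Sum>f\<in>inj_PiE Q R. G U f)"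
    by (rule sum.swap)
  also have "fact (card R - card Q) * \<dots> =
      (\<Sum>U\<in>Pow Q. fact (card R - card Q) * (\<Sum>f\<in>inj_PiE Q R. G U f))"
    by (rule sum_distrib_left)
  also have "\<dots> = (\<Sum>U\<in>Pow Q. fact (card R - card U) * (\<Sum>f\<in>inj_PiE U R. G U f))"
  proof (intro sum.cong refl)
    fix U assume "U \<in> Pow Q"
    then have U: "U \<union> (Q - U) = Q" "finite U" using assms finite_subset by auto
    have "fact (card R - card (U \<union> (Q - U))) * (\<Sum>f\<in>inj_PiE (U \<union> (Q - U)) R. G U f) =
        fact (card R - card U) * (\<Sum>f\<in>inj_PiE U R. G U f)"
      by (rule sum_inj_PiE_extend)
        (use assms U in \<open>auto simp: G_def intro!: idet_cong\<close>)
    then show "fact (card R - card Q) * (\<Sum>f\<in>inj_PiE Q R. G U f) =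
        fact (card R - card U) * (\<Sum>f\<in>inj_PiE U R. G U f)"
      unfolding U .
  qed
  also have "\<dots> = (\<Sum>U\<in>Pow Q. fact (card R - card U) *
       idet Q (\<lambda>i j. if i \<in> U then \<Sum>r\<in>R. u r i * v r j else \<psi> i j))"
    unfolding G_def by (intro sum.cong refl) (use assms in \<open>simp add: idet_gram_rows\<close>)
  finally show ?thesis .
qed

text \<open>The Gram expansion leaves only products over pairwise distinct rows, and these are the
  moments that \<open>int\<close> has to supply. The resulting deterministic sum is
  \<open>sum_idet_shifted_gram\<close> with the factorial divided out.\<close>

lemma has_bochner_integral_idet_gram:
  fixes g :: "'r \<Rightarrow> 'i \<Rightarrow> 'w \<Rightarrow> complex"
  assumes "finite Q" "finite R" "card Q \<le> card R"
    and int: "\<And>f p. f \<in> inj_PiE Q R \<Longrightarrow> p permutes Q \<Longrightarrow>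
      has_bochner_integral M (\<lambda>\<omega>. \<Prod>i\<in>Q. cnj (g (f i) i \<omega>) * g (f i) (p i) \<omega>)
        (\<Prod>i\<in>Q. \<psi> i (p i) + cnj (m (f i) i) * m (f i) (p i))"
  shows "has_bochner_integral M (\<lambda>\<omega>. idet Q (\<lambda>i j. \<Sum>r\<in>R. cnj (g r i \<omega>) * g r j \<omega>))
    (\<Sum>U\<in>Pow Q. fact (card R - card U) / fact (card R - card Q) *
       idet Q (\<lambda>i j. if i \<in> U then \<Sum>r\<in>R. cnj (m r i) * m r j else \<psi> i j))"
proof -
  have "has_bochner_integral M
    (\<lambda>\<omega>. \<Sum>f\<in>inj_PiE Q R. idet Q (\<lambda>i j. cnj (g (f i) i \<omega>) * g (f i) j \<omega>))
    (\<Sum>f\<in>inj_PiE Q R. idet Q (\<lambda>i j. \<psi> i j + cnj (m (f i) i) * m (f i) j))"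
    unfolding idet_def using int
    by (intro has_bochner_integral_sum has_bochner_integral_mult_right) auto
  moreover have "(\<Sum>f\<in>inj_PiE Q R. idet Q (\<lambda>i j. \<psi> i j + cnj (m (f i) i) * m (f i) j)) =
    (\<Sum>U\<in>Pow Q. fact (card R - card U) / fact (card R - card Q) *
       idet Q (\<lambda>i j. if i \<in> U then \<Sum>r\<in>R. cnj (m r i) * m r j else \<psi> i j))"
    using sum_idet_shifted_gram[OF assms(1-3), of \<psi> "\<lambda>r i. cnj (m r i)" m]
    by (simp add: field_simps sum_divide_distrib[symmetric])
  ultimately show ?thesis
    using assms(1,2) by (simp add: idet_gram)
qed

text \<open>Averaging the row expansion over all permutations of the index set turns it into a sum of
  squared moduli (Cauchy--Binet with repetitions).\<close>

lemma idet_gram_nonneg: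
  fixes g :: "'r \<Rightarrow> 'i \<Rightarrow> complex"
  assumes "finite S" "finite R"
  shows "Re (idet S (\<lambda>i j. \<Sum>r\<in>R. cnj (g r i) * g r j)) \<ge> 0"
proof -
  define D where "D f = idet S (\<lambda>i j. g (f i) j)" for f :: "'i \<Rightarrow> 'r"
  define c where "c f = (\<Prod>i\<in>S. cnj (g (f i) i))" for f :: "'i \<Rightarrow> 'r"
  let ?W = "\<lambda>i j. \<Sum>r\<in>R. cnj (g r i) * g r j"
  have W: "idet S ?W = (\<Sum>f\<in>S \<rightarrow>\<^sub>E R. c f * D f)"
  proof -
    have "idet S ?W = idet S (\<lambda>i j. if i \<in> S then ?W i j else 0)"
      by (rule idet_cong) auto
    also have "\<dots> = (\<Sum>f\<in>S \<rightarrow>\<^sub>E R. idet S (\<lambda>i j. if i \<in> S then cnj (g (f i) i) * g (f i) j else 0))"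
      by (rule idet_sum_rows) (use assms in auto)
    also have "\<dots> = (\<Sum>f\<in>S \<rightarrow>\<^sub>E R. idet S (\<lambda>i j. cnj (g (f i) i) * g (f i) j))"
      by (intro sum.cong refl idet_cong) auto
    finally show ?thesis by (simp add: idet_row_scale c_def D_def)
  qed
  \<comment> \<open>Replacing \<open>f\<close> by \<open>f \<circ> p\<close> permutes the index set
    of the sum, while \<open>D\<close> changes only by the sign of \<open>p\<close>.\<close>
  have perm: "(\<Sum>f\<in>S \<rightarrow>\<^sub>E R. c f * D f) = (\<Sum>f\<in>S \<rightarrow>\<^sub>E R. of_int (sign p) * c (f \<circ> p) * D f)"
    if p: "p permutes S" for p
  proof -
    have "f \<circ> p \<in> S \<rightarrow>\<^sub>E R" if "f \<in> S \<rightarrow>\<^sub>E R" "p permutes S" for f p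
      using that by (auto simp: PiE_iff extensional_def permutes_in_image permutes_not_in)
    then have "(\<Sum>f\<in>S \<rightarrow>\<^sub>E R. c f * D f) = (\<Sum>f\<in>S \<rightarrow>\<^sub>E R. c (f \<circ> p) * D (f \<circ> p))"
      using p
      by (intro sum.reindex_bij_witness[where j = "\<lambda>f. f \<circ> Hilbert_Choice.inv p" and i = "\<lambda>f. f \<circ> p"])
        (auto simp: permutes_inv o_assoc[symmetric] permutes_inv_o)
    moreover have "D (f \<circ> p) = of_int (sign p) * D f" for f
      using idet_permute_rows[OF assms(1) p, of "\<lambda>i j. g (f i) j"] by (simp add: D_def)
    ultimately show ?thesis by (simp add: mult_ac)
  qed
  have "of_nat (fact (card S)) * idet S ?W = (\<Sum>p | p permutes S. \<Sum>f\<in>S \<rightarrow>\<^sub>E R. of_int (sign p) * c (f \<circ> p) * D f)"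
  proof -
    have "of_nat (fact (card S)) * idet S ?W = (\<Sum>p | p permutes S. \<Sum>f\<in>S \<rightarrow>\<^sub>E R. c f * D f)"
      using W card_permutations[OF refl assms(1)] by simp
    also have "\<dots> = (\<Sum>p | p permutes S. \<Sum>f\<in>S \<rightarrow>\<^sub>E R. of_int (sign p) * c (f \<circ> p) * D f)"
      by (intro sum.cong refl perm) auto
    finally show ?thesis .
  qed
  also have "\<dots> = (\<Sum>f\<in>S \<rightarrow>\<^sub>E R. (\<Sum>p | p permutes S. of_int (sign p) * c (f \<circ> p)) * D f)"
    by (subst sum.swap) (simp add: sum_distrib_right)
  \<comment> \<open>The signed sum of \<open>c (f \<circ> p)\<close> is the Leibniz formula for the
    conjugate of the transposed determinant \<open>D f\<close>.\<close>
  also have "\<dots> = (\<Sum>f\<in>S \<rightarrow>\<^sub>E R. cnj (D f) * D f)"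
  proof (intro sum.cong refl arg_cong2[where f = "(*)"])
    fix f
    have "D f = idet S (\<lambda>i j. g (f j) i)"
      unfolding D_def by (rule idet_transpose[OF assms(1), symmetric])
    then show "(\<Sum>p | p permutes S. of_int (sign p) * c (f \<circ> p)) = cnj (D f)"
      by (simp add: idet_def c_def)
  qed
  also have "\<dots> = of_real (\<Sum>f\<in>S \<rightarrow>\<^sub>E R. (cmod (D f))\<^sup>2)"
    unfolding of_real_sum
    by (intro sum.cong refl) (subst mult.commute, rule complex_norm_square[symmetric])
  finally have "Re (of_nat (fact (card S)) * idet S ?W) = (\<Sum>f\<in>S \<rightarrow>\<^sub>E R. (cmod (D f))\<^sup>2)"
    by (simp only: Re_complex_of_real)
  also have "Re (of_nat (fact (card S)) * idet S ?W) = of_nat (fact (card S)) * Re (idet S ?W)"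
    by (simp only: times_complex.sel complex_Re_of_nat complex_Im_of_nat mult_zero_left diff_zero)
  finally have "of_nat (fact (card S)) * Re (idet S ?W) \<ge> 0"
    by (simp only: sum_nonneg zero_le_power2)
  moreover have "(0::real) < of_nat (fact (card S))"
    by (simp only: of_nat_0_less_iff fact_gt_zero)
  ultimately show ?thesis
    by (meson zero_le_mult_iff not_less)
qed

section \<open>The function J as a weighted sum of elementary symmetric functions\<close>

definition bordered_vandermonde :: "nat \<Rightarrow> (nat \<Rightarrow> 'a) \<Rightarrow> (nat \<Rightarrow> 'a) \<Rightarrow> 'a::comm_ring_1 mat" where
  "bordered_vandermonde L x l = mat (Suc L) (Suc L) (\<lambda>(i, j). if i < L then x i ^ j else l j)"

text \<open>The cofactor of the border entry \<open>l j\<close>: a signed Vandermonde minor with the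
  power \<open>j\<close> skipped. It does not depend on the border.\<close>

definition border_cofactor :: "nat \<Rightarrow> (nat \<Rightarrow> 'a) \<Rightarrow> nat \<Rightarrow> 'a::comm_ring_1" where
  "border_cofactor L x j =
     (-1) ^ (L + j) * det (mat L L (\<lambda>(i, k). x i ^ (if k < j then k else Suc k)))"

lemma det_bordered_vandermonde:
  "det (bordered_vandermonde L x l) = (\<Sum>j\<le>L. l j * border_cofactor L x j)"
proof -
  let ?M = "bordered_vandermonde L x l"
  have "mat_delete ?M L j = mat L L (\<lambda>(i, k). x i ^ (if k < j then k else Suc k))" if "j \<le> L" for j
    by (rule eq_matI) (use that in \<open>auto simp: mat_delete_def bordered_vandermonde_def\<close>)
  then have "cofactor ?M L j = border_cofactor L x j" if "j \<le> L" for j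
    using that by (simp add: cofactor_def border_cofactor_def)
  moreover have "det ?M = (\<Sum>j<Suc L. ?M $$ (L, j) * cofactor ?M L j)"
    by (rule laplace_expansion_row) (auto simp: bordered_vandermonde_def)
  ultimately show ?thesis
    by (auto simp: lessThan_Suc_atMost bordered_vandermonde_def intro!: sum.cong)
qed

lemma border_cofactor_last: "border_cofactor L x L = det (mat L L (\<lambda>(i, j). x i ^ j))"
proof -
  have "mat L L (\<lambda>(i, k). x i ^ (if k < L then k else Suc k)) = mat L L (\<lambda>(i, j). x i ^ j)"
    by (rule eq_matI) auto
  then show ?thesis by (simp add: border_cofactor_def)
qed

text \<open>As a function of \<open>y\<close>, the bordered determinant with last row \<open>(-y) ^ j\<close> is a polynomial
  of degree at most \<open>L\<close> that vanishes at the points \<open>- x i\<close>.\<close>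

lemma border_cofactor_eq_coeff:
  fixes x :: "nat \<Rightarrow> 'a::{idom, ring_char_0}"
  assumes "inj_on x {..<L}" "j \<le> L"
  shows "(-1) ^ j * border_cofactor L x j =
    (-1) ^ L * det (mat L L (\<lambda>(i, j). x i ^ j)) * coeff (\<Prod>i<L. [:x i, 1:]) j"
proof -
  define p where "p = (\<Sum>j\<le>L. monom ((-1) ^ j * border_cofactor L x j) j)"
  define q where "q = (\<Prod>i<L. [:x i, 1:])"
  define c where "c = (-1) ^ L * det (mat L L (\<lambda>(i, j). x i ^ j))"
  have coeff_p: "coeff p j = (if j \<le> L then (-1) ^ j * border_cofactor L x j else 0)" for j
    by (simp add: p_def coeff_sum)
  have poly_p: "poly p y = det (bordered_vandermonde L x (\<lambda>j. (- y) ^ j))" for y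
    unfolding det_bordered_vandermonde p_def
    by (simp add: poly_sum poly_monom power_minus[of y] mult_ac)
  have degree_q: "degree q = L"
    unfolding q_def by (subst degree_prod_eq_sum_degree) auto
  have "lead_coeff q = 1"
    unfolding q_def lead_coeff_prod by simp
  \<comment> \<open>Both sides have degree at most \<open>L\<close>, agree at the \<open>L\<close>
    distinct points \<open>- x i\<close>, and have the same coefficient at \<open>L\<close>.\<close>
  have "p = Polynomial.smult c q"
  proof (rule poly_eqI_degree_lead_coeff[where n = L and A = "(\<lambda>i. - x i) ` {..<L}"])
    fix y assume "y \<in> (\<lambda>i. - x i) ` {..<L}"
    then obtain i where i: "i < L" "y = - x i" by auto
    have "det (bordered_vandermonde L x (\<lambda>j. (- y) ^ j)) = 0"
      by (rule det_identical_rows[of _ "Suc L" i L])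
        (use i in \<open>auto simp: bordered_vandermonde_def\<close>)
    moreover have "poly q y = 0"
      unfolding q_def using i by (auto simp: poly_prod intro!: prod_zero)
    ultimately show "poly p y = poly (Polynomial.smult c q) y"
      by (simp add: poly_p)
  next
    show "coeff p L = coeff (Polynomial.smult c q) L"
      using \<open>lead_coeff q = 1\<close> by (simp add: coeff_p c_def border_cofactor_last degree_q)
    have "inj_on (\<lambda>i. - x i) {..<L}"
      using assms by (auto simp: inj_on_def)
    then show "L \<le> card ((\<lambda>i. - x i) ` {..<L})"
      by (simp add: card_image)
    show "degree p \<le> L" by (rule degree_le) (simp add: coeff_p)
    show "degree (Polynomial.smult c q) \<le> L" using degree_q by simp
  qed
  then have "coeff p j = c * coeff q j" by simp
  then show ?thesis using assms(2) by (simp add: coeff_p c_def q_def)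
qed

text \<open>With border \<open>x L ^ j\<close> the bordered determinant is the next Vandermonde
  determinant. Its cofactor expansion evaluates the product of the factors \<open>[:x i, 1:]\<close>
  at \<open>- x L\<close>, and the two signs \<open>(-1) ^ L\<close> cancel.\<close>

lemma det_vandermonde:
  fixes x :: "nat \<Rightarrow> 'a::{idom, ring_char_0}"
  assumes "inj_on x {..<L}"
  shows "det (mat L L (\<lambda>(i, j). x i ^ j)) = (\<Prod>j<L. \<Prod>i<j. x j - x i)"
  using assms
proof (induction L)
  case (Suc L)
  have inj: "inj_on x {..<L}" using Suc.prems by (rule inj_on_subset) auto
  let ?V = "det (mat L L (\<lambda>(i, j). x i ^ j))" and ?q = "\<Prod>i<L. [:x i, 1:]"
  have "mat (Suc L) (Suc L) (\<lambda>(i, j). x i ^ j) = bordered_vandermonde L x (\<lambda>j. x L ^ j)"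
    unfolding bordered_vandermonde_def by (rule eq_matI) (auto simp: less_Suc_eq)
  then have "det (mat (Suc L) (Suc L) (\<lambda>(i, j). x i ^ j)) = (\<Sum>j\<le>L. x L ^ j * border_cofactor L x j)"
    by (simp add: det_bordered_vandermonde)
  also have "\<dots> = (\<Sum>j\<le>L. (- x L) ^ j * ((-1) ^ j * border_cofactor L x j))"
    by (intro sum.cong refl) (simp add: power_minus[of "x L"] mult_ac)
  also have "\<dots> = (\<Sum>j\<le>L. (- x L) ^ j * ((-1) ^ L * ?V * coeff ?q j))"
    by (intro sum.cong refl arg_cong2[where f = "(*)"] border_cofactor_eq_coeff inj) auto
  also have "\<dots> = (-1) ^ L * ?V * (\<Sum>j\<le>L. coeff ?q j * (- x L) ^ j)"
    by (simp add: sum_distrib_left mult_ac)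
  also have "(\<Sum>j\<le>L. coeff ?q j * (- x L) ^ j) = poly ?q (- x L)"
  proof -
    have "degree ?q = L" by (subst degree_prod_eq_sum_degree) auto
    then show ?thesis by (simp add: poly_altdef)
  qed
  also have "\<dots> = (\<Prod>i<L. - (x L - x i))"
    by (simp add: poly_prod)
  also have "\<dots> = (-1) ^ L * (\<Prod>i<L. x L - x i)"
    by (subst prod_uminus) simp
  finally show ?case using Suc.IH[OF inj] by (simp add: mult_ac flip: power_add mult_2)
qed simp

text \<open>The border \<open>l\<close> is chosen so that the column operations encoded in \<open>E\<close> annihilate the last
  row except for its final entry.\<close>

lemma det_shifted_vandermonde:
  fixes x c :: "nat \<Rightarrow> 'a::{idom, ring_char_0}"
  assumes "inj_on x {..<L}" and c: "\<And>j. j < L \<Longrightarrow> c j \<noteq> 0"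
  shows "det (mat L L (\<lambda>(i, j). (c j + x i) * x i ^ j)) =
    (\<Prod>j<L. \<Prod>i<j. x j - x i) * (\<Sum>j\<le>L. (\<Prod>i<j. c i) * coeff (\<Prod>i<L. [:x i, 1:]) j)"
proof -
  \<comment> \<open>This solves \<open>l j * c j + l (Suc j) = 0\<close> with
    \<open>l 0 = 1\<close>.\<close>
  define l where "l j = (-1) ^ j * (\<Prod>i<j. c i)" for j
  \<comment> \<open>Multiplication by \<open>E\<close> on the right turns column
    \<open>j < L\<close> into \<open>c j\<close> times itself plus column \<open>Suc j\<close>, and
    keeps column \<open>L\<close>.\<close>
  define E where "E = mat (Suc L) (Suc L) (\<lambda>(k, j).
    if k = j then (if j < L then c j else 1) else if k = Suc j then 1 else 0)"
  let ?M = "bordered_vandermonde L x l" and ?D = "mat L L (\<lambda>(i, j). (c j + x i) * x i ^ j)"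
  let ?q = "\<Prod>i<L. [:x i, 1:]"
  define B where "B = mat (Suc L) (Suc L) (\<lambda>(i, j).
     if j < L then (if i < L then (c j + x i) * x i ^ j else 0) else (if i < L then x i ^ L else l L))"
  have "det E = (\<Prod>i<Suc L. E $$ (i, i))"
    by (subst det_lower_triangular[of "Suc L"])
       (auto simp: E_def prod_list_diag_prod lessThan_atLeast0 simp del: upt_Suc)
  also have "\<dots> = (\<Prod>i<L. c i)"
    by (simp add: E_def)
  finally have det_E: "det E = (\<Prod>i<L. c i)" .
  have "?M * E = B"
  proof (rule eq_matI)
    fix i j assume ij: "i < dim_row B" "j < dim_col B"
    let ?r = "\<lambda>k. if i < L then x i ^ k else l k"
    have "(?M * E) $$ (i, j) = (\<Sum>k<Suc L. ?r k * E $$ (k, j))"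
      using ij by (simp add: bordered_vandermonde_def E_def B_def scalar_prod_def lessThan_atLeast0)
    also have "\<dots> = (\<Sum>k\<in>(if j < L then {j, Suc j} else {j}). ?r k * E $$ (k, j))"
      by (rule sum.mono_neutral_right) (use ij in \<open>auto simp: E_def B_def\<close>)
    also have "\<dots> = B $$ (i, j)"
      using ij by (cases "j = L") (auto simp: E_def B_def l_def algebra_simps)
    finally show "(?M * E) $$ (i, j) = B $$ (i, j)" .
  qed (auto simp: bordered_vandermonde_def E_def B_def)
  then have "det B = det ?M * det E"
    using det_mult[of ?M "Suc L" E] by (simp add: bordered_vandermonde_def E_def)
  moreover have "det B = l L * det ?D"
  proof -
    have "det B = (\<Sum>j<Suc L. B $$ (L, j) * cofactor B L j)"
      by (rule laplace_expansion_row) (auto simp: B_def)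
    also have "\<dots> = l L * cofactor B L L"
      by (simp add: B_def)
    also have "mat_delete B L L = ?D"
      by (rule eq_matI) (auto simp: B_def mat_delete_def)
    then have "cofactor B L L = det ?D" by (simp add: cofactor_def)
    finally show ?thesis .
  qed
  moreover have "det ?M = (-1) ^ L * det (mat L L (\<lambda>(i, j). x i ^ j)) * (\<Sum>j\<le>L. (\<Prod>i<j. c i) * coeff ?q j)"
  proof -
    have "det ?M = (\<Sum>j\<le>L. (\<Prod>i<j. c i) * ((-1) ^ j * border_cofactor L x j))"
      unfolding det_bordered_vandermonde l_def by (simp add: mult_ac)
    also have "\<dots> = (\<Sum>j\<le>L. (\<Prod>i<j. c i) * ((-1) ^ L * det (mat L L (\<lambda>(i, j). x i ^ j)) * coeff ?q j))"
      by (intro sum.cong refl arg_cong2[where f = "(*)"] border_cofactor_eq_coeff assms) auto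
    finally show ?thesis by (simp add: sum_distrib_left mult_ac)
  qed
  \<comment> \<open>The product of all \<open>c i\<close> occurs both in \<open>det E\<close> and in
    \<open>l L\<close>; being non-zero, it cancels.\<close>
  moreover have "l L = (-1) ^ L * (\<Prod>i<L. c i)" "(\<Prod>i<L. c i) \<noteq> 0"
    using c by (auto simp: l_def)
  ultimately show ?thesis
    using det_vandermonde[OF assms(1)] det_E by simp
qed

text \<open>A further linear factor combines two neighbouring coefficients by one product and one
  sum, so limits pass through by induction. This is the continuity behind the limit in
  \<open>J\<close>.\<close>

lemma tendsto_coeff_prod_linear:
  fixes f :: "'i \<Rightarrow> 'b \<Rightarrow> 'a::{real_normed_field}"
  assumes "finite S" "\<And>i. i \<in> S \<Longrightarrow> (f i \<longlongrightarrow> l i) F"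
  shows "((\<lambda>s. coeff (\<Prod>i\<in>S. [:f i s, 1:]) j) \<longlongrightarrow> coeff (\<Prod>i\<in>S. [:l i, 1:]) j) F"
  using assms
proof (induction S arbitrary: j rule: finite_induct)
  case (insert i S)
  have *: "coeff (\<Prod>i\<in>insert i S. [:h i, 1:]) j =
     h i * coeff (\<Prod>i\<in>S. [:h i, 1:]) j + (case j of 0 \<Rightarrow> 0 | Suc k \<Rightarrow> coeff (\<Prod>i\<in>S. [:h i, 1:]) k)"
    for h :: "'i \<Rightarrow> 'a"
    using insert by (simp add: coeff_pCons split: nat.split)
  show ?case
    unfolding * by (cases j) (auto intro!: tendsto_intros insert)
qed simp

text \<open>Since \<open>length ths \<le> n\<close>, the shifts in \<open>J_raw\<close> are positive
  natural numbers, and their partial products are the quotients of factorials.\<close>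

lemma J_raw_eq:
  assumes "distinct ths" "length ths \<le> n"
  shows "J_raw (int n) ths = (\<Sum>j\<le>length ths. fact (n - length ths + j) / fact (n - length ths) *
    coeff (\<Prod>i<length ths. [:ths ! i, 1:]) j)"
proof -
  define L where "L = length ths"
  define c :: "nat \<Rightarrow> complex" where "c j = of_nat (n - L + (j + 1))" for j
  have c: "c j \<noteq> 0" for j unfolding c_def of_nat_eq_0_iff by simp
  have inj: "inj_on (\<lambda>i. ths ! i) {..<L}"
    using assms by (auto simp: inj_on_def L_def nth_eq_iff_index_eq)
  then have V: "(\<Prod>j<L. \<Prod>i<j. ths ! j - ths ! i) \<noteq> 0"
    by (fastforce dest: inj_onD)
  have prod_c: "(\<Prod>i<j. c i) = fact (n - L + j) / fact (n - L)" for j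
    by (induction j) (auto simp: c_def field_simps)
  have "J_raw (int n) ths =
    det (mat L L (\<lambda>(i, j). (c j + ths ! i) * (ths ! i) ^ j)) / (\<Prod>j<L. \<Prod>i<j. ths ! j - ths ! i)"
    using assms by (simp add: J_raw_def Let_def L_def[symmetric] c_def of_nat_diff algebra_simps)
  also have "\<dots> = (\<Sum>j\<le>L. (\<Prod>i<j. c i) * coeff (\<Prod>i<L. [:ths ! i, 1:]) j)"
    using det_shifted_vandermonde[OF inj, of c] c V by simp
  finally show ?thesis unfolding prod_c L_def .
qed

text \<open>For small non-zero \<open>s\<close> the perturbed arguments are distinct, so
  \<open>J_raw_eq\<close> applies. Its right-hand side is continuous in \<open>s\<close>, and the
  limit is its value at \<open>s = 0\<close>.\<close>

lemma J_eq:
  assumes "length ths \<le> n"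
  shows "J (int n) ths = (\<Sum>j\<le>length ths. fact (n - length ths + j) / fact (n - length ths) *
    coeff (\<Prod>x\<leftarrow>ths. [:x, 1:]) j)"
proof -
  define L where "L = length ths"
  define pert where "pert s = map (\<lambda>(i, x). x + s * of_nat i) (List.enumerate 0 ths)" for s :: complex
  have len: "length (pert s) = L" for s by (simp add: pert_def L_def)
  have nth: "pert s ! i = ths ! i + s * of_nat i" if "i < L" for s i
    using that by (simp add: pert_def L_def nth_enumerate_eq)
  have "\<forall>\<^sub>F s in at 0. ths ! i + s * of_nat i \<noteq> ths ! k + s * of_nat k" if "i \<noteq> k" for i k
  \<comment> \<open>Equal arguments are separated by every non-zero \<open>s\<close>; different ones
    stay apart near 0 by continuity.\<close>
  proof (cases "ths ! i = ths ! k")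
    case True
    have "\<forall>\<^sub>F s :: complex in at 0. s \<noteq> 0" by (auto simp: eventually_at_filter)
    then show ?thesis by eventually_elim (use True that in auto)
  next
    case False
    have "((\<lambda>s. (ths ! i + s * of_nat i) - (ths ! k + s * of_nat k)) \<longlongrightarrow>
      (ths ! i + 0 * of_nat i) - (ths ! k + 0 * of_nat k)) (at 0)"
      by (intro tendsto_intros)
    then have "\<forall>\<^sub>F s in at 0. (ths ! i + s * of_nat i) - (ths ! k + s * of_nat k) \<noteq> 0"
      by (rule tendsto_imp_eventually_ne) (use False in auto)
    then show ?thesis by eventually_elim auto
  qed
  then have "\<forall>\<^sub>F s in at 0. \<forall>i\<in>{..<L}. \<forall>k\<in>{..<L} - {i}. ths ! i + s * of_nat i \<noteq> ths ! k + s * of_nat k"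
    by (intro eventually_ball_finite ballI) auto
  then have "\<forall>\<^sub>F s in at 0. distinct (pert s)"
    by eventually_elim (auto simp: distinct_conv_nth len nth)
  then have ev: "\<forall>\<^sub>F s in at 0. (\<Sum>j\<le>L. fact (n - L + j) / fact (n - L) *
      coeff (\<Prod>i<L. [:ths ! i + s * of_nat i, 1:]) j) = J_raw (int n) (pert s)"
  proof eventually_elim
    case (elim s)
    from J_raw_eq[OF this, of n] show ?case
      using assms by (simp add: len L_def[symmetric] nth)
  qed
  have "((\<lambda>s. \<Sum>j\<le>L. fact (n - L + j) / fact (n - L) *
      coeff (\<Prod>i<L. [:ths ! i + s * of_nat i, 1:]) j) \<longlongrightarrow>
      (\<Sum>j\<le>L. fact (n - L + j) / fact (n - L) * coeff (\<Prod>i<L. [:ths ! i + 0 * of_nat i, 1:]) j)) (at 0)"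
    by (intro tendsto_intros tendsto_coeff_prod_linear) auto
  then have "((\<lambda>s. J_raw (int n) (pert s)) \<longlongrightarrow>
      (\<Sum>j\<le>L. fact (n - L + j) / fact (n - L) * coeff (\<Prod>i<L. [:ths ! i + 0 * of_nat i, 1:]) j)) (at 0)"
    by (rule Lim_transform_eventually) (rule ev)
  then have "J (int n) ths = (\<Sum>j\<le>L. fact (n - L + j) / fact (n - L) * coeff (\<Prod>i<L. [:ths ! i + 0 * of_nat i, 1:]) j)"
    unfolding J_def pert_def[symmetric] by (intro tendsto_Lim) auto
  moreover have "(\<Prod>x\<leftarrow>ths. [:x, 1:]) = (\<Prod>i<L. [:ths ! i, 1:])"
    by (simp add: prod.list_conv_set_nth L_def lessThan_atLeast0)
  ultimately show ?thesis by (simp add: L_def)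
qed

section \<open>Determinantal pencils and eigenvalues\<close>

text \<open>The choice in \<open>eigvals\<close> has a witness because a complex characteristic
  polynomial splits into linear factors.\<close>

lemma eigvals_props:
  assumes "A \<in> carrier_mat n n"
  shows "length (eigvals A) = n" "char_poly A = (\<Prod>a\<leftarrow>eigvals A. [:- a, 1:])"
proof -
  have "\<exists>as. length as = dim_row A \<and> char_poly A = (\<Prod>a\<leftarrow>as. [:- a, 1:])"
    using char_poly_factorized[OF assms] assms by auto
  from someI_ex[OF this] show "length (eigvals A) = n" "char_poly A = (\<Prod>a\<leftarrow>eigvals A. [:- a, 1:])"
    using assms by (auto simp: eigvals_def)
qed

text \<open>Evaluate the factored characteristic polynomial at \<open>- y\<close>; the sign
  \<open>(-1) ^ n\<close> appears on both sides.\<close>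

lemma det_add_scalar_eq_prod_eigvals:
  assumes "A \<in> carrier_mat n n"
  shows "det (A + y \<cdot>\<^sub>m 1\<^sub>m n) = (\<Prod>a\<leftarrow>eigvals A. y + a)"
proof -
  let ?M = "A + y \<cdot>\<^sub>m 1\<^sub>m n"
  have "(\<Prod>a\<leftarrow>as. - a - y) = (-1) ^ length as * (\<Prod>a\<leftarrow>as. y + a)" for as :: "complex list"
    by (induction as) (auto simp: algebra_simps)
  then have "(-1) ^ n * (\<Prod>a\<leftarrow>eigvals A. y + a) = poly (char_poly A) (- y)"
    using eigvals_props[OF assms] by (simp add: poly_prod_list o_def)
  also have "\<dots> = det (- ?M)"
    using char_poly_matrix[OF assms, of "- y"] assms by (simp add: char_matrix_def)
  also have "- ?M = (-1) \<cdot>\<^sub>m ?M"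
    by (rule eq_matI) (use assms in auto)
  also have "det \<dots> = (-1) ^ n * det ?M"
    using assms by simp
  finally show ?thesis by simp
qed

lemma minv_props:
  assumes A: "A \<in> carrier_mat n n" and d: "det A \<noteq> 0"
  shows "A * minv A = 1\<^sub>m n" "minv A \<in> carrier_mat n n"
proof -
  obtain B where "mat_inverse A = Some B"
    using mat_inverse(1)[OF A] det_non_zero_imp_unit[OF A d] by fastforce
  with mat_inverse(2)[OF A this] show "A * minv A = 1\<^sub>m n" "minv A \<in> carrier_mat n n"
    by (auto simp: minv_def)
qed

lemma det_pencil_eq_prod_eigvals:
  assumes A: "A \<in> carrier_mat n n" and B: "B \<in> carrier_mat n n" and d: "det A \<noteq> 0"
  shows "det (B + y \<cdot>\<^sub>m A) = det A * (\<Prod>a\<leftarrow>eigvals (minv A * B). y + a)"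
proof -
  note inv = minv_props[OF A d]
  have "A * (minv A * B) = B"
    using inv A B by (simp add: assoc_mult_mat[symmetric, of _ n n _ n _ n])
  then have "A * (minv A * B + y \<cdot>\<^sub>m 1\<^sub>m n) = B + y \<cdot>\<^sub>m A"
    using inv A B by (simp add: mult_add_distrib_mat[of _ n n _ n] mult_smult_distrib[of _ n n _ n])
  then have "det (B + y \<cdot>\<^sub>m A) = det A * det (minv A * B + y \<cdot>\<^sub>m 1\<^sub>m n)"
    using det_mult[of A n "minv A * B + y \<cdot>\<^sub>m 1\<^sub>m n"] inv A B by simp
  then show ?thesis
    using det_add_scalar_eq_prod_eigvals[of "minv A * B" n y] inv B by simp
qed

text \<open>Each zero in the list contributes a factor \<open>[:0, 1:]\<close>, a shift of the
  coefficients by one. This accounts for the zero eigenvalues that \<open>J\<close> is not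
  given.\<close>

lemma prod_list_nonzero_split:
  "(\<Prod>a\<leftarrow>as. [:a, 1:]) =
    monom 1 (length as - length (filter (\<lambda>x. x \<noteq> 0) as)) * (\<Prod>a\<leftarrow>filter (\<lambda>x. x \<noteq> 0) as. [:a, 1:])"
  for as :: "'a::comm_ring_1 list"
proof (induction as)
  case (Cons a as)
  have "length (filter (\<lambda>x. x \<noteq> 0) as) \<le> length as" by simp
  then show ?case
    using Cons by (cases "a = 0")
      (auto simp: Suc_diff_le monom_Suc mult.left_commute simp del: mult_pCons_left mult_pCons_right,
       simp add: mult_pCons_left)
qed (simp add: monom_0 one_pCons)

text \<open>The pencil polynomial \<open>det (\<Sigma>_Q + y \<Psi>_Q)\<close> is written in two
  ways: by choosing rows \<open>U\<close> from \<open>\<Sigma>\<close>, and by eigenvalues. Applying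
  the same linear functional \<open>\<Lambda>\<close> to its coefficients in both forms gives the
  two sides.\<close>

lemma sum_idet_eq_J:
  assumes \<Psi>: "\<Psi> \<in> carrier_mat N N" and \<Sigma>: "\<Sigma> \<in> carrier_mat N N"
    and Q: "Q \<subseteq> {..<N}" "card Q \<le> n" and d: "det (principal_submat \<Psi> Q) \<noteq> 0"
  defines "ths \<equiv> nonzero_eigvals (minv (principal_submat \<Psi> Q) * principal_submat \<Sigma> Q)"
  shows "(\<Sum>U\<in>Pow Q. fact (n - card U) / fact (n - card Q) *
      idet Q (\<lambda>i j. if i \<in> U then \<Sigma> $$ (i, j) else \<Psi> $$ (i, j))) =
    det (principal_submat \<Psi> Q) * J (int n) ths *
      complex_of_real (fact (n - length ths) / fact (n - card Q))"
proof -
  define t where "t = card Q"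
  define A where "A = minv (principal_submat \<Psi> Q) * principal_submat \<Sigma> Q"
  define L where "L = length ths"
  define D where "D U = idet Q (\<lambda>i j. if i \<in> U then \<Sigma> $$ (i, j) else \<Psi> $$ (i, j))" for U
  define r where "r = (\<Prod>a\<leftarrow>ths. [:a, 1:])"
  \<comment> \<open>The set \<open>U\<close> contributes to the coefficient
    \<open>m = t - card U\<close>, where the weight \<open>fact (n - t + m)\<close> is the required
    \<open>fact (n - card U)\<close>.\<close>
  define \<Lambda> where "\<Lambda> p = (\<Sum>m\<le>t. fact (n - t + m) / fact (n - t) * coeff p m)" for p :: "complex poly"
  let ?P = "principal_submat \<Psi> Q" and ?S = "principal_submat \<Sigma> Q"
  have fin: "finite Q" using Q finite_subset by auto
  have carr: "?P \<in> carrier_mat t t" "?S \<in> carrier_mat t t"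
    by (auto simp: principal_submat_def t_def)
  have A: "A \<in> carrier_mat t t"
    unfolding A_def using minv_props(2)[OF carr(1) d] carr by simp
  have len: "length (eigvals A) = t" using eigvals_props[OF A] by simp
  have ths: "ths = filter (\<lambda>x. x \<noteq> 0) (eigvals A)"
    by (simp add: ths_def nonzero_eigvals_def A_def)
  have L: "L \<le> t" using len unfolding L_def ths by (metis length_filter_le)
  have pow: "card U \<le> t" if "U \<in> Pow Q" for U
    using that fin by (auto simp: t_def intro: card_mono)
  have "poly (\<Sum>U\<in>Pow Q. monom (D U) (t - card U)) y =
        poly (Polynomial.smult (det ?P) (\<Prod>a\<leftarrow>eigvals A. [:a, 1:])) y" for y
  proof -
    have "poly (Polynomial.smult (det ?P) (\<Prod>a\<leftarrow>eigvals A. [:a, 1:])) y = det (?S + y \<cdot>\<^sub>m ?P)"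
      using det_pencil_eq_prod_eigvals[OF carr d, of y] by (simp add: A_def poly_prod_list o_def add.commute)
    also have "?S + y \<cdot>\<^sub>m ?P = principal_submat (\<Sigma> + y \<cdot>\<^sub>m \<Psi>) Q"
    proof (rule eq_matI)
      fix i j assume "i < dim_row (principal_submat (\<Sigma> + y \<cdot>\<^sub>m \<Psi>) Q)"
        "j < dim_col (principal_submat (\<Sigma> + y \<cdot>\<^sub>m \<Psi>) Q)"
      then have ij: "i < card Q" "j < card Q" by (auto simp: principal_submat_def)
      have "sorted_list_of_set Q ! k < N" if "k < card Q" for k
        using nth_mem[of k "sorted_list_of_set Q"] that Q fin by auto
      then show "(?S + y \<cdot>\<^sub>m ?P) $$ (i, j) = principal_submat (\<Sigma> + y \<cdot>\<^sub>m \<Psi>) Q $$ (i, j)"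
        using ij \<Psi> \<Sigma> by (simp add: principal_submat_def)
    qed (auto simp: principal_submat_def)
    also have "det \<dots> = idet Q (\<lambda>i j. \<Sigma> $$ (i, j) + y * \<Psi> $$ (i, j))"
        unfolding det_principal_submat[OF fin]
      by (rule idet_cong) (use \<Psi> \<Sigma> in \<open>simp add: subsetD[OF Q(1), simplified]\<close>)
    also have "\<dots> = (\<Sum>U\<in>Pow Q. y ^ (t - card U) * D U)"
      unfolding idet_add[OF fin]
    proof (intro sum.cong refl)
      fix U assume U: "U \<in> Pow Q"
      have "idet Q (\<lambda>i j. if i \<in> U then \<Sigma> $$ (i, j) else y * \<Psi> $$ (i, j)) =
        idet Q (\<lambda>i j. (if i \<in> U then 1 else y) * (if i \<in> U then \<Sigma> $$ (i, j) else \<Psi> $$ (i, j)))"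
        by (rule idet_cong) auto
      also have "\<dots> = (\<Prod>i\<in>Q. if i \<in> U then 1 else y) * D U"
        unfolding D_def by (rule idet_row_scale)
      also have "(\<Prod>i\<in>Q. if i \<in> U then 1 else y) = y ^ card (Q - U)"
        using U fin by (simp add: prod_if_subset)
      also have "card (Q - U) = t - card U"
        using U fin by (auto simp: t_def intro!: card_Diff_subset finite_subset[of U Q])
      finally show "idet Q (\<lambda>i j. if i \<in> U then \<Sigma> $$ (i, j) else y * \<Psi> $$ (i, j)) = y ^ (t - card U) * D U" .
    qed
    finally show ?thesis by (simp add: poly_sum poly_monom mult.commute)
  qed
  \<comment> \<open>Equality of values at every complex \<open>y\<close> gives equality of
    polynomials.\<close>
  then have eq: "(\<Sum>U\<in>Pow Q. monom (D U) (t - card U)) = Polynomial.smult (det ?P) (monom 1 (t - L) * r)"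
    using prod_list_nonzero_split[of "eigvals A"]
    by (simp add: poly_eq_poly_eq_iff[symmetric] fun_eq_iff ths[symmetric] len L_def[symmetric] r_def)
  have "\<Lambda> (\<Sum>U\<in>Pow Q. monom (D U) (t - card U)) = (\<Sum>U\<in>Pow Q. \<Lambda> (monom (D U) (t - card U)))"
    unfolding \<Lambda>_def coeff_sum sum_distrib_left by (rule sum.swap)
  also have "\<dots> = (\<Sum>U\<in>Pow Q. fact (n - card U) / fact (n - t) * D U)"
  proof (intro sum.cong refl)
    fix U assume "U \<in> Pow Q"
    then have U: "card U \<le> t" by (rule pow)
    have "\<Lambda> (monom (D U) (t - card U)) =
      (\<Sum>m\<le>t. if m = t - card U then fact (n - t + m) / fact (n - t) * D U else 0)"
      unfolding \<Lambda>_def by (intro sum.cong refl) auto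
    also have "\<dots> = fact (n - t + (t - card U)) / fact (n - t) * D U"
      by simp
    also have "n - t + (t - card U) = n - card U"
      using U Q(2) by (simp add: t_def)
    finally show "\<Lambda> (monom (D U) (t - card U)) = fact (n - card U) / fact (n - t) * D U" .
  qed
  finally have 1: "(\<Sum>U\<in>Pow Q. fact (n - card U) / fact (n - t) * D U) =
      \<Lambda> (Polynomial.smult (det ?P) (monom 1 (t - L) * r))"
    unfolding eq ..
  have "\<Lambda> (Polynomial.smult (det ?P) (monom 1 (t - L) * r)) =
    (\<Sum>m\<le>t. fact (n - t + m) / fact (n - t) * (det ?P * (if m < t - L then 0 else coeff r (m - (t - L)))))"
    unfolding \<Lambda>_def by (intro sum.cong refl) (auto simp: coeff_monom_mult)
  also have "\<dots> = (\<Sum>m\<in>{t - L..t}. fact (n - t + m) / fact (n - t) * (det ?P * coeff r (m - (t - L))))"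
    by (rule sum.mono_neutral_cong_right) auto
  \<comment> \<open>Undoing the shift by the \<open>t - L\<close> zero eigenvalues, with
    \<open>m = j + (t - L)\<close>, turns \<open>n - t + m\<close> into
    \<open>n - L + j\<close>.\<close>
  also have "\<dots> = (\<Sum>j\<le>L. fact (n - L + j) / fact (n - t) * (det ?P * coeff r j))"
    by (rule sum.reindex_bij_witness[where i = "\<lambda>j. j + (t - L)" and j = "\<lambda>m. m - (t - L)"])
       (use L Q(2) in \<open>auto simp: t_def\<close>)
  \<comment> \<open>Normalising by \<open>fact (n - L)\<close>, as \<open>J_eq\<close> does, instead
    of \<open>fact (n - t)\<close> produces the quotient of factorials beside
    \<open>J\<close>.\<close>
  also have "\<dots> = det ?P * (\<Sum>j\<le>L. fact (n - L + j) / fact (n - L) * coeff r j) *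
      complex_of_real (fact (n - L) / fact (n - t))"
    by (simp add: sum_distrib_left sum_distrib_right field_simps)
  also have "(\<Sum>j\<le>L. fact (n - L + j) / fact (n - L) * coeff r j) = J (int n) ths"
    unfolding r_def L_def by (rule J_eq[symmetric]) (use L Q(2) in \<open>simp add: L_def t_def\<close>)
  finally show ?thesis
    using 1 unfolding D_def t_def L_def by simp
qed

section \<open>Complex Gaussian moments\<close>

text \<open>Lebesgue measure is determined by its values on boxes, and a complex box is a product of
  two intervals.\<close>

lemma lborel_complex_eq:
  "(lborel :: complex measure) = distr (lborel \<Otimes>\<^sub>M lborel) borel (\<lambda>(x, y). Complex x y)"
proof (rule lborel_eqI)
  have meas [measurable]: "(\<lambda>(x, y). Complex x y) \<in> borel_measurable (lborel \<Otimes>\<^sub>M lborel)"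
    unfolding Complex_eq case_prod_beta by measurable
  fix l u :: complex
  assume lu: "\<And>b. b \<in> Basis \<Longrightarrow> l \<bullet> b \<le> u \<bullet> b"
  have le: "Re l \<le> Re u" "Im l \<le> Im u"
    using lu[of 1] lu[of \<i>] by (auto simp: Basis_complex_def inner_complex_def)
  have "(\<lambda>(x, y). Complex x y) -` box l u \<inter> space (lborel \<Otimes>\<^sub>M lborel) =
      {Re l<..<Re u} \<times> {Im l<..<Im u}"
    by (auto simp: in_box_complex_iff space_pair_measure)
  then have "emeasure (distr (lborel \<Otimes>\<^sub>M lborel) borel (\<lambda>(x, y). Complex x y)) (box l u) =
      emeasure (lborel \<Otimes>\<^sub>M lborel) ({Re l<..<Re u} \<times> {Im l<..<Im u})"
    by (simp add: emeasure_distr[OF meas])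
  also have "\<dots> = ennreal ((Re u - Re l) * (Im u - Im l))"
    using le by (simp add: lborel.emeasure_pair_measure_Times ennreal_mult)
  finally show "emeasure (distr (lborel \<Otimes>\<^sub>M lborel) borel (\<lambda>(x, y). Complex x y)) (box l u) =
    ennreal (\<Prod>b\<in>Basis. (u - l) \<bullet> b)"
    by (simp add: Basis_complex_def inner_complex_def)
qed simp

text \<open>The law of the real and of the imaginary part: standard deviation
  \<open>1 / sqrt 2\<close>, so that the two variances add up to 1.\<close>

abbreviation normal_var_half :: "real measure" where
  "normal_var_half \<equiv> density lborel (normal_density 0 (1 / sqrt 2))"

text \<open>The density \<open>exp (- (cmod z)\<^sup>2) / pi\<close> factors into the two normal
  densities of the coordinates.\<close>

lemma cgauss_eq_distr:
  "cgauss = distr (normal_var_half \<Otimes>\<^sub>M normal_var_half) borel (\<lambda>(x, y). Complex x y)"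
proof -
  have [measurable]: "(\<lambda>(x, y). Complex x y) \<in> borel_measurable (lborel \<Otimes>\<^sub>M lborel)"
    unfolding Complex_eq case_prod_beta by measurable
  interpret prob_space normal_var_half by (rule prob_space_normal_density) simp
  have "cgauss = distr (density (lborel \<Otimes>\<^sub>M lborel)
      (\<lambda>w. ennreal (exp (- (cmod (case w of (x, y) \<Rightarrow> Complex x y))\<^sup>2) / pi))) borel (\<lambda>(x, y). Complex x y)"
    unfolding cgauss_def lborel_complex_eq by (subst density_distr) measurable
  also have "(\<lambda>w. ennreal (exp (- (cmod (case w of (x, y) \<Rightarrow> Complex x y))\<^sup>2) / pi)) =
    (\<lambda>(x, y). ennreal (normal_density 0 (1 / sqrt 2) x) * ennreal (normal_density 0 (1 / sqrt 2) y))"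
    by (auto simp: fun_eq_iff normal_density_def cmod_def ennreal_mult[symmetric] power_divide
        exp_add[symmetric] field_simps simp flip: exp_minus)
  also have "density (lborel \<Otimes>\<^sub>M lborel) \<dots> = normal_var_half \<Otimes>\<^sub>M normal_var_half"
    by (rule pair_measure_density[symmetric]) (auto intro: sigma_finite_measure_axioms lborel.sigma_finite_measure_axioms)
  finally show ?thesis .
qed

lemma sets_cgauss [measurable_cong, simp]: "sets cgauss = sets borel"
  by (simp add: cgauss_def)

lemma (in prob_space) distr_pair_snd:
  assumes "sigma_finite_measure N"
  shows "distr (M \<Otimes>\<^sub>M N) N snd = N"
proof (intro measure_eqI)
  interpret N: sigma_finite_measure N by fact
  fix A assume A: "A \<in> sets (distr (M \<Otimes>\<^sub>M N) N snd)"
  then have "emeasure (distr (M \<Otimes>\<^sub>M N) N snd) A = emeasure (M \<Otimes>\<^sub>M N) (space M \<times> A)"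
    by (auto simp add: emeasure_distr space_pair_measure dest: sets.sets_into_space intro!: arg_cong2[where f=emeasure])
  with A show "emeasure (distr (M \<Otimes>\<^sub>M N) N snd) A = emeasure N A"
    by (simp add: N.emeasure_pair_measure_Times emeasure_space_1)
qed simp

lemma has_bochner_integral_distrD:
  fixes f :: "'b \<Rightarrow> 'c::{banach, second_countable_topology}"
  assumes "has_bochner_integral (distr M N T) f c" "T \<in> M \<rightarrow>\<^sub>M N" "f \<in> borel_measurable N"
  shows "has_bochner_integral M (\<lambda>x. f (T x)) c"
  using assms by (simp add: has_bochner_integral_iff integrable_distr_eq integral_distr)

lemma has_bochner_integral_normal_var_half:
  "has_bochner_integral normal_var_half (\<lambda>x. x) 0"
  "has_bochner_integral normal_var_half (\<lambda>x. x\<^sup>2) (1 / 2)"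
proof -
  have "has_bochner_integral lborel (\<lambda>x. normal_density 0 (1 / sqrt 2) x * (x - 0) ^ (2 * 0 + 1)) 0"
    by (rule normal_moment_odd) simp
  then show "has_bochner_integral normal_var_half (\<lambda>x. x) 0"
    by (simp add: has_bochner_integral_iff integrable_density integral_density)
  have "has_bochner_integral lborel (\<lambda>x. normal_density 0 (1 / sqrt 2) x * (x - 0) ^ (2 * 1))
      (fact (2 * 1) / ((2 / (1 / sqrt 2)\<^sup>2) ^ 1 * fact 1))"
    by (rule normal_moment_even) simp
  then show "has_bochner_integral normal_var_half (\<lambda>x. x\<^sup>2) (1 / 2)"
    by (simp add: has_bochner_integral_iff integrable_density integral_density power_divide)
qed

interpretation cgauss: prob_space cgauss
proof -
  interpret prob_space normal_var_half by (rule prob_space_normal_density) simp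
  interpret pair_prob_space normal_var_half normal_var_half ..
  show "prob_space cgauss"
    unfolding cgauss_eq_distr by (rule P.prob_space_distr) (unfold Complex_eq case_prod_beta, measurable)
qed

text \<open>Both moments are computed from the two real coordinates: the means vanish, and the
  squared modulus collects 1/2 from each coordinate.\<close>

lemma has_bochner_integral_cgauss:
  "has_bochner_integral cgauss (\<lambda>z. z) 0"
  "has_bochner_integral cgauss (\<lambda>z. cnj z * z) 1"
proof -
  interpret H: prob_space normal_var_half by (rule prob_space_normal_density) simp
  let ?P = "normal_var_half \<Otimes>\<^sub>M normal_var_half"
  have [measurable]: "(\<lambda>(x, y). Complex x y) \<in> borel_measurable ?P"
    unfolding Complex_eq case_prod_beta by measurable
  have fst: "has_bochner_integral ?P (\<lambda>w. f (fst w)) c" and snd: "has_bochner_integral ?P (\<lambda>w. f (snd w)) c"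
    if "has_bochner_integral normal_var_half f c" "f \<in> borel_measurable borel" for f :: "real \<Rightarrow> real" and c
  proof -
    show "has_bochner_integral ?P (\<lambda>w. f (fst w)) c"
      by (rule has_bochner_integral_distrD[where N = normal_var_half])
        (use that H.distr_pair_fst[of normal_var_half] in auto)
    show "has_bochner_integral ?P (\<lambda>w. f (snd w)) c"
      by (rule has_bochner_integral_distrD[where N = normal_var_half])
        (use that H.distr_pair_snd[OF H.sigma_finite_measure_axioms] in auto)
  qed
  note * = fst[OF has_bochner_integral_normal_var_half(1)] snd[OF has_bochner_integral_normal_var_half(1)]
    fst[OF has_bochner_integral_normal_var_half(2)] snd[OF has_bochner_integral_normal_var_half(2)]
  have "has_bochner_integral ?P (\<lambda>w. of_real (fst w) + \<i> * of_real (snd w)) (of_real 0 + \<i> * of_real 0 :: complex)"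
    by (intro has_bochner_integral_add has_bochner_integral_of_real has_bochner_integral_mult_right) (simp_all add: *)
  then show "has_bochner_integral cgauss (\<lambda>z. z) 0"
    unfolding cgauss_eq_distr
    by (simp add: has_bochner_integral_iff integrable_distr_eq integral_distr case_prod_beta Complex_eq)
  have "has_bochner_integral ?P (\<lambda>w. of_real ((fst w)\<^sup>2 + (snd w)\<^sup>2)) (of_real (1 / 2 + 1 / 2) :: complex)"
    by (intro has_bochner_integral_add has_bochner_integral_of_real) (simp_all add: *)
  moreover have "of_real ((fst w)\<^sup>2 + (snd w)\<^sup>2) = cnj (Complex (fst w) (snd w)) * Complex (fst w) (snd w)" for w
    by (simp add: complex_eq_iff power2_eq_square)
  ultimately have "has_bochner_integral ?P
     (\<lambda>w. cnj (Complex (fst w) (snd w)) * Complex (fst w) (snd w)) 1"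
    by simp
  moreover have "(\<lambda>z. cnj z * z) \<in> borel_measurable borel"
    by (intro borel_measurable_continuous_onI continuous_intros)
  ultimately show "has_bochner_integral cgauss (\<lambda>z. cnj z * z) 1"
    unfolding cgauss_eq_distr
    by (simp add: has_bochner_integral_iff integrable_distr_eq integral_distr case_prod_beta)
qed

text \<open>Treats the entries of both noise matrices as one independent family, indexed by the
  disjoint sum. Independence is shown by identifying the joint law with the product measure on
  boxes.\<close>

lemma indep_vars_pair_PiM:
  assumes c: "prob_space c" and fin: "finite I" "finite K" and ne: "I <+> K \<noteq> {}"
  defines "X \<equiv> (\<lambda>x w. case x of Inl a \<Rightarrow> fst w a | Inr b \<Rightarrow> snd w b)"
  shows "prob_space.indep_vars (PiM I (\<lambda>_. c) \<Otimes>\<^sub>M PiM K (\<lambda>_. c)) (\<lambda>_. c) X (I <+> K)"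
    and "\<And>x. x \<in> I <+> K \<Longrightarrow> distr (PiM I (\<lambda>_. c) \<Otimes>\<^sub>M PiM K (\<lambda>_. c)) c (X x) = c"
proof -
  let ?A = "PiM I (\<lambda>_. c)" and ?B = "PiM K (\<lambda>_. c)"
  let ?P = "?A \<Otimes>\<^sub>M ?B"
  interpret c: prob_space c by fact
  interpret A: prob_space ?A by (rule prob_space_PiM) (rule c)
  interpret B: prob_space ?B by (rule prob_space_PiM) (rule c)
  interpret P: pair_prob_space ?A ?B ..
  interpret S: product_sigma_finite "\<lambda>_. c" ..
  have rv: "X x \<in> ?P \<rightarrow>\<^sub>M c" if "x \<in> I <+> K" for x
    using that unfolding X_def by (auto simp: Plus_def)
  show distr: "distr ?P c (X x) = c" if "x \<in> I <+> K" for x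
  proof (cases x)
    case (Inl a)
    then have a: "a \<in> I" using that by auto
    have "distr ?P c (X x) = distr (distr ?P ?A fst) c (\<lambda>v. v a)"
      using a by (subst distr_distr) (auto simp: X_def Inl o_def)
    also have "\<dots> = c"
      using a c distr_PiM_component[of I "\<lambda>_. c" a] by (simp add: B.distr_pair_fst)
    finally show ?thesis .
  next
    case (Inr b)
    then have b: "b \<in> K" using that by auto
    have "distr ?P c (X x) = distr (distr ?P ?B snd) c (\<lambda>v. v b)"
      using b by (subst distr_distr) (auto simp: X_def Inr o_def)
    also have "\<dots> = c"
      using b c distr_PiM_component[of K "\<lambda>_. c" b]
      by (simp add: A.distr_pair_snd[OF B.sigma_finite_measure_axioms])
    finally show ?thesis .
  qed
  have "distr ?P (PiM (I <+> K) (\<lambda>_. c)) (\<lambda>w. \<lambda>x\<in>I <+> K. X x w) = PiM (I <+> K) (\<lambda>_. c)"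
  proof (rule S.PiM_eqI)
    fix A assume A: "\<And>x. x \<in> I <+> K \<Longrightarrow> A x \<in> sets c"
    have "(\<lambda>w. \<lambda>x\<in>I <+> K. X x w) -` Pi\<^sub>E (I <+> K) A \<inter> space ?P =
        Pi\<^sub>E I (\<lambda>a. A (Inl a)) \<times> Pi\<^sub>E K (\<lambda>b. A (Inr b))"
    proof (rule Set.set_eqI, unfold split_paired_all)
      fix u v
      have Plus: "(\<forall>x\<in>I <+> K. C x) \<longleftrightarrow> (\<forall>a\<in>I. C (Inl a)) \<and> (\<forall>b\<in>K. C (Inr b))" for C
        by (auto simp: Plus_def)
      \<comment> \<open>As each \<open>A x\<close> lies in \<open>space c\<close>, membership in the
        boxes implies the range conditions that come from \<open>space ?P\<close>.\<close>
      have sub: "(\<forall>a\<in>I. A (Inl a) \<subseteq> space c) \<and> (\<forall>b\<in>K. A (Inr b) \<subseteq> space c)"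
        using A[THEN sets.sets_into_space] by blast
      have "(u, v) \<in> (\<lambda>w. \<lambda>x\<in>I <+> K. X x w) -` Pi\<^sub>E (I <+> K) A \<inter> space ?P \<longleftrightarrow>
        (\<forall>a\<in>I. u a \<in> A (Inl a)) \<and> (\<forall>b\<in>K. v b \<in> A (Inr b)) \<and>
        u \<in> I \<rightarrow>\<^sub>E space c \<and> v \<in> K \<rightarrow>\<^sub>E space c"
        by (simp add: X_def restrict_PiE_iff Pi_iff Plus space_pair_measure space_PiM)
      also have "\<dots> \<longleftrightarrow> (u, v) \<in> Pi\<^sub>E I (\<lambda>a. A (Inl a)) \<times> Pi\<^sub>E K (\<lambda>b. A (Inr b))"
        unfolding mem_Sigma_iff PiE_iff using sub by blast
      finally show "(u, v) \<in> (\<lambda>w. \<lambda>x\<in>I <+> K. X x w) -` Pi\<^sub>E (I <+> K) A \<inter> space ?P \<longleftrightarrow>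
        (u, v) \<in> Pi\<^sub>E I (\<lambda>a. A (Inl a)) \<times> Pi\<^sub>E K (\<lambda>b. A (Inr b))" .
    qed
    then have "emeasure (distr ?P (PiM (I <+> K) (\<lambda>_. c)) (\<lambda>w. \<lambda>x\<in>I <+> K. X x w)) (Pi\<^sub>E (I <+> K) A) =
        emeasure ?P (Pi\<^sub>E I (\<lambda>a. A (Inl a)) \<times> Pi\<^sub>E K (\<lambda>b. A (Inr b)))"
      using A fin rv by (subst emeasure_distr) (auto intro!: measurable_restrict sets_PiM_I_finite)
    also have "\<dots> = emeasure ?A (Pi\<^sub>E I (\<lambda>a. A (Inl a))) * emeasure ?B (Pi\<^sub>E K (\<lambda>b. A (Inr b)))"
      using A fin by (intro B.emeasure_pair_measure_Times) (auto intro!: sets_PiM_I_finite)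
    also have "\<dots> = (\<Prod>a\<in>I. emeasure c (A (Inl a))) * (\<Prod>b\<in>K. emeasure c (A (Inr b)))"
      using A fin by (subst (1 2) S.emeasure_PiM) auto
    also have "\<dots> = (\<Prod>x\<in>I <+> K. emeasure c (A x))"
      using fin by (simp add: prod.Plus o_def)
    finally show "emeasure (distr ?P (PiM (I <+> K) (\<lambda>_. c)) (\<lambda>w. \<lambda>x\<in>I <+> K. X x w)) (Pi\<^sub>E (I <+> K) A) =
      (\<Prod>x\<in>I <+> K. emeasure c (A x))" .
  qed (use fin in auto)
  also have "\<dots> = PiM (I <+> K) (\<lambda>x. distr ?P c (X x))"
    by (intro PiM_cong refl) (simp add: distr)
  finally show "P.indep_vars (\<lambda>_. c) X (I <+> K)"
    using ne by (subst P.indep_vars_iff_distr_eq_PiM') (auto simp: rv)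
qed

section \<open>Moments of products of independent rows\<close>

context prob_space
begin

lemma has_bochner_integral_cnj_mult_indep:
  fixes X :: "'i \<Rightarrow> 'a \<Rightarrow> complex"
  assumes indep: "indep_vars (\<lambda>_. borel) X I" and xy: "x \<in> I" "y \<in> I"
    and mean: "\<And>x. x \<in> I \<Longrightarrow> has_bochner_integral M (X x) 0"
    and var: "\<And>x. x \<in> I \<Longrightarrow> has_bochner_integral M (\<lambda>\<omega>. cnj (X x \<omega>) * X x \<omega>) 1"
  shows "has_bochner_integral M (\<lambda>\<omega>. cnj (X x \<omega>) * X y \<omega>) (if x = y then 1 else 0)"
proof (cases "x = y")
  case False
  \<comment> \<open>The conjugate is attached to the index \<open>x\<close> only, so that the
    product of \<open>Z\<close> over \<open>{x, y}\<close> is the desired integrand.\<close>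
  define Z where "Z z \<omega> = (if z = x then cnj (X z \<omega>) else X z \<omega>)" for z \<omega>
  have cnj_meas: "cnj \<in> borel_measurable borel"
    by (intro borel_measurable_continuous_onI continuous_intros)
  have "indep_vars (\<lambda>_. borel) X {x, y}"
    by (rule indep_vars_subset[OF indep]) (use xy in auto)
  then have "indep_vars (\<lambda>_. borel) (\<lambda>z \<omega>. (if z = x then cnj else (\<lambda>v. v)) (X z \<omega>)) {x, y}"
    by (rule indep_vars_compose2) (auto simp: cnj_meas)
  also have "(\<lambda>z \<omega>. (if z = x then cnj else (\<lambda>v. v)) (X z \<omega>)) = Z"
    by (auto simp: Z_def fun_eq_iff)
  finally have Z: "indep_vars (\<lambda>_. borel) Z {x, y}" .
  have mZ: "has_bochner_integral M (Z z) 0" if "z \<in> {x, y}" for z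
    using that mean[OF xy(1)] mean[OF xy(2)] False
    by (auto simp: Z_def[abs_def] has_bochner_integral_iff)
  have "integrable M (\<lambda>\<omega>. \<Prod>z\<in>{x, y}. Z z \<omega>)" "(\<integral>\<omega>. (\<Prod>z\<in>{x, y}. Z z \<omega>) \<partial>M) = (\<Prod>z\<in>{x, y}. \<integral>\<omega>. Z z \<omega> \<partial>M)"
    using mZ by (auto intro!: indep_vars_integrable indep_vars_lebesgue_integral Z simp only: has_bochner_integral_iff finite.intros)
  then show ?thesis
    using False mean[OF xy(1)] by (simp add: has_bochner_integral_iff Z_def)
qed (use var xy in auto)

text \<open>Injectivity of \<open>f\<close> makes the blocks \<open>K (f i)\<close> disjoint, so the
  factors are functions of disjoint groups of independent variables and the expectation factorises.
  Within one factor only the deterministic term and the diagonal covariances survive.\<close>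

lemma has_bochner_integral_prod_indep_rows:
  fixes X :: "'i \<Rightarrow> 'a \<Rightarrow> complex" and m :: "'r \<Rightarrow> 'j \<Rightarrow> complex" and b :: "'i \<Rightarrow> 'j \<Rightarrow> complex"
  assumes indep: "indep_vars (\<lambda>_. borel) X I" and fin: "finite I"
    and mean: "\<And>x. x \<in> I \<Longrightarrow> has_bochner_integral M (X x) 0"
    and var: "\<And>x. x \<in> I \<Longrightarrow> has_bochner_integral M (\<lambda>\<omega>. cnj (X x \<omega>) * X x \<omega>) 1"
    and K: "\<And>r. r \<in> R \<Longrightarrow> K r \<subseteq> I" "disjoint_family_on K R"
    and Q: "finite Q" and f: "f \<in> inj_PiE Q R"
  shows "has_bochner_integral M
    (\<lambda>\<omega>. \<Prod>i\<in>Q. cnj (m (f i) i + (\<Sum>x\<in>K (f i). b x i * X x \<omega>)) * (m (f i) (p i) + (\<Sum>x\<in>K (f i). b x (p i) * X x \<omega>)))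
    (\<Prod>i\<in>Q. (\<Sum>x\<in>K (f i). cnj (b x i) * b x (p i)) + cnj (m (f i) i) * m (f i) (p i))"
proof -
  define Y where "Y i v = cnj (m (f i) i + (\<Sum>x\<in>K (f i). b x i * v x)) *
     (m (f i) (p i) + (\<Sum>x\<in>K (f i). b x (p i) * v x))" for i and v :: "'i \<Rightarrow> complex"
  have fR: "f i \<in> R" if "i \<in> Q" for i using f that by auto
  have finK: "finite (K (f i))" if "i \<in> Q" for i
    using K(1)[OF fR[OF that]] fin finite_subset by auto
  have "disjoint_family_on (\<lambda>i. K (f i)) Q"
    unfolding disjoint_family_on_def
  proof (intro ballI impI)
    fix i k assume "i \<in> Q" "k \<in> Q" "i \<noteq> k"
    then have "f i \<noteq> f k" "f i \<in> R" "f k \<in> R" using f by (auto simp: inj_on_def)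
    then show "K (f i) \<inter> K (f k) = {}" using K(2) by (auto simp: disjoint_family_on_def)
  qed
  then have "indep_vars (\<lambda>i. PiM (K (f i)) (\<lambda>_. borel)) (\<lambda>i \<omega>. restrict (\<lambda>x. X x \<omega>) (K (f i))) Q"
    by (intro indep_vars_restrict[OF indep]) (use K(1) fR in auto)
  then have "indep_vars (\<lambda>_. borel) (\<lambda>i \<omega>. Y i (restrict (\<lambda>x. X x \<omega>) (K (f i)))) Q"
  proof (rule indep_vars_compose2)
    have cnj_meas: "cnj \<in> borel_measurable borel"
      by (intro borel_measurable_continuous_onI continuous_intros)
    fix i assume "i \<in> Q"
    show "Y i \<in> borel_measurable (PiM (K (f i)) (\<lambda>_. borel))"
      unfolding Y_def
      by (intro borel_measurable_times borel_measurable_add borel_measurable_sum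
          measurable_compose[OF _ cnj_meas] measurable_const measurable_component_singleton) auto
  qed
  also have "(\<lambda>i \<omega>. Y i (restrict (\<lambda>x. X x \<omega>) (K (f i)))) = (\<lambda>i \<omega>. Y i (\<lambda>x. X x \<omega>))"
    by (simp add: Y_def)
  finally have indepY: "indep_vars (\<lambda>_. borel) (\<lambda>i \<omega>. Y i (\<lambda>x. X x \<omega>)) Q" .
  have mom: "has_bochner_integral M (\<lambda>\<omega>. Y i (\<lambda>x. X x \<omega>))
      ((\<Sum>x\<in>K (f i). cnj (b x i) * b x (p i)) + cnj (m (f i) i) * m (f i) (p i))" if i: "i \<in> Q" for i
  proof -
    let ?K = "K (f i)" and ?m = "m (f i)"
    note KI = subsetD[OF K(1)[OF fR[OF i]]]
    have cov: "has_bochner_integral M (\<lambda>\<omega>. cnj (X x \<omega>) * X y \<omega>) (if x = y then 1 else 0)"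
      if "x \<in> ?K" "y \<in> ?K" for x y
      using that KI by (intro has_bochner_integral_cnj_mult_indep[OF indep] mean var)
    have mean_cnj: "has_bochner_integral M (\<lambda>\<omega>. cnj (X x \<omega>)) (cnj 0)" if "x \<in> I" for x
      using mean[OF that] by (simp add: has_bochner_integral_iff)
    \<comment> \<open>The four parts of the expanded product: noise times noise, mean times mean,
      and two mixed terms with expectation 0.\<close>
    have "has_bochner_integral M (\<lambda>\<omega>.
        (\<Sum>x\<in>?K. \<Sum>y\<in>?K. cnj (b x i) * b y (p i) * (cnj (X x \<omega>) * X y \<omega>)) +
        cnj (?m i) * ?m (p i) + cnj (?m i) * (\<Sum>y\<in>?K. b y (p i) * X y \<omega>) +
        ?m (p i) * (\<Sum>x\<in>?K. cnj (b x i) * cnj (X x \<omega>)))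
      ((\<Sum>x\<in>?K. \<Sum>y\<in>?K. cnj (b x i) * b y (p i) * (if x = y then 1 else 0)) +
        cnj (?m i) * ?m (p i) + cnj (?m i) * (\<Sum>y\<in>?K. b y (p i) * 0) +
        ?m (p i) * (\<Sum>x\<in>?K. cnj (b x i) * cnj 0))"
      by (intro has_bochner_integral_add has_bochner_integral_sum has_bochner_integral_mult_right
          cov mean mean_cnj KI)
        (auto simp: has_bochner_integral_iff prob_space)
    moreover have "Y i v = (\<Sum>x\<in>?K. \<Sum>y\<in>?K. cnj (b x i) * b y (p i) * (cnj (v x) * v y)) +
        cnj (?m i) * ?m (p i) + cnj (?m i) * (\<Sum>y\<in>?K. b y (p i) * v y) +
        ?m (p i) * (\<Sum>x\<in>?K. cnj (b x i) * cnj (v x))" for v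
    proof -
      have "(\<Sum>x\<in>?K. \<Sum>y\<in>?K. cnj (b x i) * b y (p i) * (cnj (v x) * v y)) =
        (\<Sum>x\<in>?K. cnj (b x i) * cnj (v x)) * (\<Sum>y\<in>?K. b y (p i) * v y)"
        unfolding sum_product by (simp add: mult_ac)
      then show ?thesis
        unfolding Y_def by (simp add: algebra_simps)
    qed
    moreover have "(\<Sum>x\<in>?K. \<Sum>y\<in>?K. cnj (b x i) * b y (p i) * (if x = y then 1 else 0)) =
        (\<Sum>x\<in>?K. cnj (b x i) * b x (p i))"
      using finK[OF i] by (simp add: if_distrib cong: if_cong)
    ultimately show ?thesis
      by simp
  qed
  show ?thesis
    unfolding Y_def[symmetric] has_bochner_integral_iff
    using indep_vars_integrable[OF Q indepY] indep_vars_lebesgue_integral[OF Q indepY] mom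
    by (auto simp: Y_def has_bochner_integral_iff)
qed

end

section \<open>The capacity bound\<close>

text \<open>In the expansion by principal minors the empty set contributes 1, and Gram minors have
  non-negative real part.\<close>

lemma Re_idet_identity_plus_gram_ge_1:
  fixes g :: "'r \<Rightarrow> 'i \<Rightarrow> complex"
  assumes "finite S" "finite R" "c \<ge> 0"
  shows "1 \<le> Re (idet S (\<lambda>i j. (if i = j then 1 else 0) + of_real c * (\<Sum>r\<in>R. cnj (g r i) * g r j)))"
proof -
  let ?W = "\<lambda>i j. \<Sum>r\<in>R. cnj (g r i) * g r j"
  have "Re (idet S (\<lambda>i j. (if i = j then 1 else 0) + of_real c * ?W i j)) =
      (\<Sum>Q\<in>Pow S. c ^ card Q * Re (idet Q ?W))"
    unfolding idet_identity_plus[OF assms(1)] by (simp flip: of_real_power)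
  also have "\<dots> \<ge> (\<Sum>Q\<in>{{}}. c ^ card Q * Re (idet Q ?W))"
    using assms
    by (intro sum_mono2) (auto intro!: mult_nonneg_nonneg idet_gram_nonneg intro: finite_subset)
  finally show ?thesis by simp
qed

text \<open>Jensen's inequality for the logarithm. The bound \<open>1 \<le> X \<omega>\<close> keeps
  the logarithm and its tangent majorant non-negative, so \<open>ennreal\<close> truncates
  nothing.\<close>

lemma (in prob_space) nn_integral_log_le:
  assumes X: "\<And>\<omega>. \<omega> \<in> space M \<Longrightarrow> 1 \<le> X \<omega>" and int: "has_bochner_integral M X m" and b: "b > 1"
  shows "(\<integral>\<^sup>+ \<omega>. ennreal (log b (X \<omega>)) \<partial>M) \<le> ennreal (log b m)"
proof -
  have "integrable M X" "expectation X = m"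
    using int by (auto simp: has_bochner_integral_iff)
  then have "expectation (\<lambda>_. 1) \<le> m"
    using X by (subst \<open>expectation X = m\<close>[symmetric], intro integral_mono_AE) auto
  then have m: "m \<ge> 1" by (simp add: prob_space)
  \<comment> \<open>the tangent of \<open>log b\<close> at the mean \<open>m\<close>\<close>
  let ?f = "\<lambda>\<omega>. log b m + (X \<omega> / m - 1) / ln b"
  have le: "log b (X \<omega>) \<le> ?f \<omega>" if "\<omega> \<in> space M" for \<omega>
  proof -
    have "X \<omega> > 0" using X[OF that] by simp
    then have "ln (X \<omega>) - ln m \<le> X \<omega> / m - 1"
      using m ln_le_minus_one[of "X \<omega> / m"] by (simp add: ln_div)
    then have "(ln (X \<omega>) - ln m) / ln b \<le> (X \<omega> / m - 1) / ln b"
      using b by (intro divide_right_mono) auto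
    then show ?thesis by (simp add: log_def diff_divide_distrib)
  qed
  have "(\<integral>\<^sup>+ \<omega>. ennreal (log b (X \<omega>)) \<partial>M) \<le> (\<integral>\<^sup>+ \<omega>. ennreal (?f \<omega>) \<partial>M)"
    by (intro nn_integral_mono ennreal_leI le)
  also have "\<dots> = ennreal (expectation ?f)"
  proof (rule nn_integral_eq_integral)
    show "integrable M ?f" using \<open>integrable M X\<close> by auto
    have "0 \<le> ?f \<omega>" if "\<omega> \<in> space M" for \<omega>
    proof -
      have "0 \<le> log b (X \<omega>)" using X[OF that] b by simp
      then show ?thesis using le[OF that] by linarith
    qed
    then show "AE \<omega> in M. 0 \<le> ?f \<omega>" by auto
  qed
  also have "expectation ?f = log b m"
    using \<open>integrable M X\<close> \<open>expectation X = m\<close> m by (simp add: prob_space)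
  finally show ?thesis .
qed

section \<open>Entries of the channel and of Gram matrices\<close>

lemma index_mult_ris_phase_mult:
  assumes "A \<in> carrier_mat n M" "T \<in> carrier_mat M k" "r < n" "j < k"
  shows "(A * ris_phase M phase * T) $$ (r, j) = (\<Sum>a<M. A $$ (r, a) * cis (phase a) * T $$ (a, j))"
proof -
  have "(A * ris_phase M phase) $$ (r, a) = A $$ (r, a) * cis (phase a)" if "a < M" for a
    using assms that
    by (simp add: ris_phase_def scalar_prod_def if_distrib cong: if_cong)
  then show ?thesis
    using assms by (auto simp: scalar_prod_def lessThan_atLeast0 ris_phase_def intro!: sum.cong)
qed

lemma index_ctrans_mult:
  assumes "A \<in> carrier_mat n k" "i < k" "j < k"
  shows "(ctrans A * A) $$ (i, j) = (\<Sum>r<n. cnj (A $$ (r, i)) * A $$ (r, j))"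
  using assms by (auto simp: ctrans_def scalar_prod_def lessThan_atLeast0 intro!: sum.cong)

lemma ctrans_carrier: "A \<in> carrier_mat n k \<Longrightarrow> ctrans A \<in> carrier_mat k n"
  by (auto simp: ctrans_def)

text \<open>Sylvester's identity, with the scalar attached to \<open>A\<close>, passes to
  \<open>ctrans A * A\<close>, whose entries are sums over the rows of \<open>A\<close>.\<close>

lemma det_one_plus_gram:
  assumes A: "A \<in> carrier_mat n k"
  shows "det (1\<^sub>m n + c \<cdot>\<^sub>m (A * ctrans A)) =
    idet {..<k} (\<lambda>i j. (if i = j then 1 else 0) + c * (\<Sum>r<n. cnj (A $$ (r, i)) * A $$ (r, j)))"
proof -
  note A' = ctrans_carrier[OF A]
  have "c \<cdot>\<^sub>m (A * ctrans A) = (c \<cdot>\<^sub>m A) * ctrans A"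
    using A A' by (simp add: mult_smult_assoc_mat[of _ n k])
  then have "det (1\<^sub>m n + c \<cdot>\<^sub>m (A * ctrans A)) = det (1\<^sub>m k + ctrans A * (c \<cdot>\<^sub>m A))"
    using det_one_plus_mult_commute[of "c \<cdot>\<^sub>m A" n k "ctrans A"] A A' by simp
  also have "ctrans A * (c \<cdot>\<^sub>m A) = c \<cdot>\<^sub>m (ctrans A * A)"
    using A A' by (simp add: mult_smult_distrib[of _ k n _ k])
  also have "det (1\<^sub>m k + c \<cdot>\<^sub>m (ctrans A * A)) =
    idet {..<k} (\<lambda>i j. (if i = j then 1 else 0) + c * (\<Sum>r<n. cnj (A $$ (r, i)) * A $$ (r, j)))"
    using A A' by (subst det_eq_idet[of _ k])
      (auto intro!: idet_cong simp: index_ctrans_mult[OF A] simp del: index_mult_mat(1))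
  finally show ?thesis .
qed

text \<open>Pulling \<open>d\<close> out of every row leaves the identity plus \<open>c / d\<close>
  times a Gram matrix, whose determinant has real part at least 1. This makes
  \<open>\<Psi>_Q\<close> invertible.\<close>

lemma det_principal_submat_gram_plus_scalar_nonzero:
  assumes T: "T \<in> carrier_mat M N" and "c \<ge> 0" "d > 0" and Q: "Q \<subseteq> {..<N}"
  shows "det (principal_submat (complex_of_real c \<cdot>\<^sub>m (ctrans T * T) + complex_of_real d \<cdot>\<^sub>m 1\<^sub>m N) Q) \<noteq> 0"
proof -
  have fin: "finite Q" using Q finite_subset by auto
  have "det (principal_submat (complex_of_real c \<cdot>\<^sub>m (ctrans T * T) + complex_of_real d \<cdot>\<^sub>m 1\<^sub>m N) Q) =
    idet Q (\<lambda>i j. complex_of_real d * ((if i = j then 1 else 0) +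
        complex_of_real (c / d) * (\<Sum>r<M. cnj (T $$ (r, i)) * T $$ (r, j))))"
    unfolding det_principal_submat[OF fin]
  proof (rule idet_cong)
    fix i j assume "i \<in> Q" "j \<in> Q"
    then have "i < N" "j < N" using Q by auto
    then show "(complex_of_real c \<cdot>\<^sub>m (ctrans T * T) + complex_of_real d \<cdot>\<^sub>m 1\<^sub>m N) $$ (i, j) =
      complex_of_real d * ((if i = j then 1 else 0) +
        complex_of_real (c / d) * (\<Sum>r<M. cnj (T $$ (r, i)) * T $$ (r, j)))"
      using T ctrans_carrier[OF T] \<open>d > 0\<close>
      by (auto simp: index_ctrans_mult[OF T] algebra_simps simp del: index_mult_mat(1))
  qed
  also have "\<dots> = complex_of_real d ^ card Q * idet Q (\<lambda>i j. (if i = j then 1 else 0) +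
        complex_of_real (c / d) * (\<Sum>r<M. cnj (T $$ (r, i)) * T $$ (r, j)))"
    by (simp add: idet_row_scale)
  also have "\<dots> \<noteq> 0"
    using Re_idet_identity_plus_gram_ge_1[OF fin, of "{..<M}" "c / d" "\<lambda>r i. T $$ (r, i)"] assms
    by (auto simp del: of_real_divide)
  finally show ?thesis .
qed

text \<open>The determinant is expanded into principal minors, each minor is integrated exactly, and
  the logarithm is taken outside by \<open>nn_integral_log_le\<close>.\<close>

lemma ris_capacity_bound:
  fixes T Rb Hb :: "complex mat" and c bt br bd LR NR LH NH :: real and M Nr Nt :: nat
    and phase :: "nat \<Rightarrow> real"
  assumes T: "T \<in> carrier_mat M Nt" and Rb: "Rb \<in> carrier_mat Nr M" and Hb: "Hb \<in> carrier_mat Nr Nt"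
    and N: "0 < Nt" "Nt \<le> Nr"
    and pos: "bt \<ge> 0" "br \<ge> 0" "bd > 0" "LR \<ge> 0" "NR \<ge> 0" "LH \<ge> 0" "NH > 0" "c \<ge> 0"
  defines "\<Phi> \<equiv> ris_phase M phase"
  defines "Gb \<equiv> complex_of_real (sqrt (bt * br * LR)) \<cdot>\<^sub>m (Rb * \<Phi> * T)
              + complex_of_real (sqrt (bd * LH)) \<cdot>\<^sub>m Hb"
  defines "\<Psi> \<equiv> complex_of_real (bt * br * NR) \<cdot>\<^sub>m (ctrans T * T)
              + complex_of_real (bd * NH) \<cdot>\<^sub>m (1\<^sub>m Nt)"
  defines "\<Sigma> \<equiv> ctrans Gb * Gb"
  defines "G \<equiv> (\<lambda>wR wH. complex_of_real (sqrt (bt * br)) \<cdot>\<^sub>m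
      ((complex_of_real (sqrt LR) \<cdot>\<^sub>m Rb + complex_of_real (sqrt NR) \<cdot>\<^sub>m to_mat Nr M wR) * \<Phi> * T)
      + complex_of_real (sqrt bd) \<cdot>\<^sub>m
      (complex_of_real (sqrt LH) \<cdot>\<^sub>m Hb + complex_of_real (sqrt NH) \<cdot>\<^sub>m to_mat Nr Nt wH))"
  defines "\<theta>s \<equiv> (\<lambda>Q. nonzero_eigvals (minv (principal_submat \<Psi> Q) * principal_submat \<Sigma> Q))"
  shows "(\<integral>\<^sup>+ w. ennreal (log 2 (Re (det (1\<^sub>m Nr + complex_of_real c \<cdot>\<^sub>m
                      (G (fst w) (snd w) * ctrans (G (fst w) (snd w)))))))
                \<partial>(cgauss_mat_measure Nr M \<Otimes>\<^sub>M cgauss_mat_measure Nr Nt))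
    \<le> ennreal (log 2 (Re (\<Sum>t\<le>Nt. complex_of_real (c ^ t) *
         (\<Sum>Q\<in>{Q. Q \<subseteq> {..<Nt} \<and> card Q = t}. det (principal_submat \<Psi> Q) * J (int Nr) (\<theta>s Q)
             * complex_of_real (fact (Nr - length (\<theta>s Q)) / fact (Nr - t))))))"
proof -
  define I where "I n = {..<Nr} \<times> {..<n}" for n :: nat
  define P where "P = cgauss_mat_measure Nr M \<Otimes>\<^sub>M cgauss_mat_measure Nr Nt"
  define X :: "(nat \<times> nat) + (nat \<times> nat) \<Rightarrow> (nat \<times> nat \<Rightarrow> complex) \<times> (nat \<times> nat \<Rightarrow> complex) \<Rightarrow> complex"
    where "X = (\<lambda>x w. case x of Inl a \<Rightarrow> fst w a | Inr b \<Rightarrow> snd w b)"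
  \<comment> \<open>The noise entries that enter row \<open>r\<close> of the channel; for different
    \<open>r\<close> these blocks are disjoint.\<close>
  define K where "K r = ({r} \<times> {..<M}) <+> ({r} \<times> {..<Nt})" for r :: nat
  \<comment> \<open>The coefficient of noise entry \<open>x\<close> in column \<open>j\<close>:
    entries of the first matrix pass through the phases and \<open>T\<close>, entries of the second
    reach only their own column.\<close>
  define b :: "(nat \<times> nat) + (nat \<times> nat) \<Rightarrow> nat \<Rightarrow> complex" where
    "b = (\<lambda>x j. case x of Inl (r, a) \<Rightarrow> complex_of_real (sqrt (bt * br * NR)) * cis (phase a) * T $$ (a, j)
      | Inr (r, l) \<Rightarrow> if l = j then complex_of_real (sqrt (bd * NH)) else 0)"
  define g where "g r j w = Gb $$ (r, j) + (\<Sum>x\<in>K r. b x j * X x w)" for r j w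
  have PiM: "cgauss_mat_measure Nr n = PiM (I n) (\<lambda>_. cgauss)" for n
    by (simp add: cgauss_mat_measure_def I_def)
  interpret A: prob_space "cgauss_mat_measure Nr M"
    unfolding PiM by (rule prob_space_PiM) (rule cgauss.prob_space_axioms)
  interpret B: prob_space "cgauss_mat_measure Nr Nt"
    unfolding PiM by (rule prob_space_PiM) (rule cgauss.prob_space_axioms)
  interpret AB: pair_prob_space "cgauss_mat_measure Nr M" "cgauss_mat_measure Nr Nt" ..
  interpret P: prob_space P unfolding P_def by (rule AB.prob_space_axioms)
  have fin: "finite (I n)" for n by (simp add: I_def)
  have ne: "I M <+> I Nt \<noteq> {}" using N by (auto simp: I_def lessThan_empty_iff)
  note indep = indep_vars_pair_PiM[OF cgauss.prob_space_axioms fin fin ne]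
  have indep_cgauss: "P.indep_vars (\<lambda>_. cgauss) X (I M <+> I Nt)"
    unfolding P_def PiM X_def by (rule indep(1))
  have distr: "distr P cgauss (X x) = cgauss" if "x \<in> I M <+> I Nt" for x
    unfolding P_def PiM X_def by (rule indep(2)[OF that])
  have indep_borel: "P.indep_vars (\<lambda>_. borel) X (I M <+> I Nt)"
    by (rule P.indep_vars_compose2[OF indep_cgauss]) (rule measurable_ident_sets, simp)
  have rv: "X x \<in> P \<rightarrow>\<^sub>M cgauss" if "x \<in> I M <+> I Nt" for x
    using indep_cgauss that unfolding P.indep_vars_def by blast
  have id_meas: "(\<lambda>z. z) \<in> borel_measurable cgauss"
    by (rule measurable_ident_sets) simp
  have "(\<lambda>z. cnj z * z) \<in> borel_measurable borel"
    by (intro borel_measurable_continuous_onI continuous_intros)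
  then have sq_meas: "(\<lambda>z. cnj z * z) \<in> borel_measurable cgauss"
    by (simp only: measurable_cong_sets[OF sets_cgauss refl])
  have mean: "has_bochner_integral P (X x) 0"
    and var: "has_bochner_integral P (\<lambda>w. cnj (X x w) * X x w) 1" if "x \<in> I M <+> I Nt" for x
  proof -
    note D = has_bochner_integral_distrD[of P cgauss "X x", unfolded distr[OF that]]
    show "has_bochner_integral P (X x) 0"
      by (rule D[OF has_bochner_integral_cgauss(1) rv[OF that] id_meas])
    show "has_bochner_integral P (\<lambda>w. cnj (X x w) * X x w) 1"
      by (rule D[OF has_bochner_integral_cgauss(2) rv[OF that] sq_meas])
  qed

  have carr: "Rb * \<Phi> * T \<in> carrier_mat Nr Nt" "Gb \<in> carrier_mat Nr Nt"
    "\<Psi> \<in> carrier_mat Nt Nt" "\<Sigma> \<in> carrier_mat Nt Nt" "G u v \<in> carrier_mat Nr Nt" for u v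
    using T Rb Hb by (auto simp: Gb_def \<Psi>_def \<Sigma>_def G_def to_mat_def ctrans_def)
  have sum_K: "(\<Sum>x\<in>K r. h x) = (\<Sum>a<M. h (Inl (r, a))) + (\<Sum>l<Nt. h (Inr (r, l)))" for r and h :: "_ \<Rightarrow> complex"
  proof -
    have "{r} \<times> {..<n} = Pair r ` {..<n}" for n :: nat by auto
    then show ?thesis
      by (simp add: K_def sum.Plus sum.reindex inj_on_def)
  qed

  \<comment> \<open>Splits each channel entry into its mean \<open>Gb\<close> and a linear form in
    the noise; products of square roots merge by \<open>real_sqrt_mult\<close>.\<close>
  have G_eq: "G (fst w) (snd w) $$ (r, j) = g r j w" if rj: "r < Nr" "j < Nt" for r j w
  proof -
    let ?s = "\<lambda>x. complex_of_real (sqrt x)"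
    have Rw: "?s LR \<cdot>\<^sub>m Rb + ?s NR \<cdot>\<^sub>m to_mat Nr M (fst w) \<in> carrier_mat Nr M"
      using Rb by (auto simp: to_mat_def)
    have "G (fst w) (snd w) $$ (r, j) = ?s (bt * br) *
        (\<Sum>a<M. (?s LR * Rb $$ (r, a) + ?s NR * fst w (r, a)) * cis (phase a) * T $$ (a, j)) +
        ?s bd * (?s LH * Hb $$ (r, j) + ?s NH * snd w (r, j))"
    proof -
      have "((?s LR \<cdot>\<^sub>m Rb + ?s NR \<cdot>\<^sub>m to_mat Nr M (fst w)) * \<Phi> * T) $$ (r, j) =
         (\<Sum>a<M. (?s LR * Rb $$ (r, a) + ?s NR * fst w (r, a)) * cis (phase a) * T $$ (a, j))"
        unfolding \<Phi>_def index_mult_ris_phase_mult[OF Rw T rj]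
        using rj Rb by (intro sum.cong refl) (auto simp: to_mat_def)
      then show ?thesis
        using rj T Hb Rb by (simp add: G_def to_mat_def \<Phi>_def ris_phase_def del: index_mult_mat(1))
    qed
    moreover have "Gb $$ (r, j) = ?s (bt * br * LR) * (\<Sum>a<M. Rb $$ (r, a) * cis (phase a) * T $$ (a, j)) +
        ?s (bd * LH) * Hb $$ (r, j)"
      using rj T Hb Rb carr(1)
      by (simp add: Gb_def index_mult_ris_phase_mult[OF Rb T rj, of phase, folded \<Phi>_def] del: index_mult_mat(1))
    moreover have "(\<Sum>x\<in>K r. b x j * X x w) =
      ?s (bt * br * NR) * (\<Sum>a<M. fst w (r, a) * cis (phase a) * T $$ (a, j)) + ?s (bd * NH) * snd w (r, j)"
    proof -
      have "(\<Sum>l<Nt. (if l = j then ?s (bd * NH) else 0) * snd w (r, l)) =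
          (\<Sum>l<Nt. if l = j then ?s (bd * NH) * snd w (r, l) else 0)"
        by (intro sum.cong) auto
      then show ?thesis
        using rj by (simp add: sum_K b_def X_def sum_distrib_left mult_ac)
    qed
    ultimately show ?thesis
      by (simp add: g_def real_sqrt_mult sum.distrib sum_distrib_left algebra_simps)
  qed

  \<comment> \<open>The unit-modulus phases cancel, and every row \<open>r\<close> has the same
    covariance matrix.\<close>
  have \<Psi>_eq: "(\<Sum>x\<in>K r. cnj (b x i) * b x j) = \<Psi> $$ (i, j)" if ij: "i < Nt" "j < Nt" for r i j
  proof -
    have sq: "complex_of_real (sqrt x) * complex_of_real (sqrt x) = complex_of_real x" if "x \<ge> 0" for x
      using that by (simp flip: of_real_mult)
    have "(\<Sum>a<M. cnj (b (Inl (r, a)) i) * b (Inl (r, a)) j) =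
      (\<Sum>a<M. complex_of_real (bt * br * NR) * (cnj (T $$ (a, i)) * T $$ (a, j)))"
    proof (intro sum.cong refl)
      fix a
      have "cnj (b (Inl (r, a)) i) * b (Inl (r, a)) j =
        (complex_of_real (sqrt (bt * br * NR)) * complex_of_real (sqrt (bt * br * NR))) *
        (cnj (cis (phase a)) * cis (phase a)) * (cnj (T $$ (a, i)) * T $$ (a, j))"
        by (simp add: b_def mult_ac)
      also have "cnj (cis (phase a)) * cis (phase a) = 1"
        by (simp add: cis_cnj cis_mult)
      finally show "cnj (b (Inl (r, a)) i) * b (Inl (r, a)) j =
        complex_of_real (bt * br * NR) * (cnj (T $$ (a, i)) * T $$ (a, j))"
        using pos by (subst (asm) sq) auto
    qed
    moreover have "(\<Sum>l<Nt. cnj (b (Inr (r, l)) i) * b (Inr (r, l)) j) =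
       (\<Sum>l<Nt. if l = i then (if i = j then complex_of_real (bd * NH) else 0) else 0)"
      using pos by (intro sum.cong refl) (auto simp: b_def sq)
    ultimately show ?thesis
      using ij T ctrans_carrier[OF T]
      by (simp add: sum_K \<Psi>_def index_ctrans_mult[OF T] sum_distrib_left del: index_mult_mat(1))
  qed

  define E where "E Q = det (principal_submat \<Psi> Q) * J (int Nr) (\<theta>s Q)
             * complex_of_real (fact (Nr - length (\<theta>s Q)) / fact (Nr - card Q))" for Q
  have EQ: "has_bochner_integral P (\<lambda>w. idet Q (\<lambda>i j. \<Sum>r<Nr. cnj (g r i w) * g r j w)) (E Q)"
    if Q: "Q \<subseteq> {..<Nt}" for Q
  proof -
    have Q': "finite Q" "card Q \<le> Nr"
      using Q N card_mono[of "{..<Nt}" Q] finite_subset by auto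
    have "has_bochner_integral P (\<lambda>w. idet Q (\<lambda>i j. \<Sum>r\<in>{..<Nr}. cnj (g r i w) * g r j w))
      (\<Sum>U\<in>Pow Q. fact (card {..<Nr} - card U) / fact (card {..<Nr} - card Q) *
       idet Q (\<lambda>i j. if i \<in> U then \<Sum>r\<in>{..<Nr}. cnj (Gb $$ (r, i)) * Gb $$ (r, j) else \<Psi> $$ (i, j)))"
    proof (rule has_bochner_integral_idet_gram)
      fix f p assume f: "f \<in> inj_PiE Q {..<Nr}" and p: "p permutes Q"
      have "has_bochner_integral P (\<lambda>w. \<Prod>i\<in>Q. cnj (g (f i) i w) * g (f i) (p i) w)
        (\<Prod>i\<in>Q. (\<Sum>x\<in>K (f i). cnj (b x i) * b x (p i)) + cnj (Gb $$ (f i, i)) * Gb $$ (f i, p i))"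
        unfolding g_def
        by (rule P.has_bochner_integral_prod_indep_rows[OF indep_borel _ mean var _ _ Q'(1) f])
          (auto simp: fin K_def I_def disjoint_family_on_def)
      also have "(\<Prod>i\<in>Q. (\<Sum>x\<in>K (f i). cnj (b x i) * b x (p i)) + cnj (Gb $$ (f i, i)) * Gb $$ (f i, p i)) =
        (\<Prod>i\<in>Q. \<Psi> $$ (i, p i) + cnj (Gb $$ (f i, i)) * Gb $$ (f i, p i))"
      proof (intro prod.cong refl)
        fix i assume "i \<in> Q"
        then have "i < Nt" "p i < Nt"
          using Q permutes_in_image[OF p, of i] by auto
        then show "(\<Sum>x\<in>K (f i). cnj (b x i) * b x (p i)) + cnj (Gb $$ (f i, i)) * Gb $$ (f i, p i) =
          \<Psi> $$ (i, p i) + cnj (Gb $$ (f i, i)) * Gb $$ (f i, p i)"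
          by (simp only: \<Psi>_eq)
      qed
      finally show "has_bochner_integral P (\<lambda>w. \<Prod>i\<in>Q. cnj (g (f i) i w) * g (f i) (p i) w)
        (\<Prod>i\<in>Q. \<Psi> $$ (i, p i) + cnj (Gb $$ (f i, i)) * Gb $$ (f i, p i))" .
    qed (use Q' in auto)
    also have "(\<Sum>U\<in>Pow Q. fact (card {..<Nr} - card U) / fact (card {..<Nr} - card Q) *
       idet Q (\<lambda>i j. if i \<in> U then \<Sum>r\<in>{..<Nr}. cnj (Gb $$ (r, i)) * Gb $$ (r, j) else \<Psi> $$ (i, j))) =
      (\<Sum>U\<in>Pow Q. fact (Nr - card U) / fact (Nr - card Q) *
       idet Q (\<lambda>i j. if i \<in> U then \<Sigma> $$ (i, j) else \<Psi> $$ (i, j)))"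
    proof -
      have "\<Sigma> $$ (i, j) = (\<Sum>r<Nr. cnj (Gb $$ (r, i)) * Gb $$ (r, j))" if "i \<in> Q" "j \<in> Q" for i j
        unfolding \<Sigma>_def by (rule index_ctrans_mult[OF carr(2)]) (use that Q in auto)
      then show ?thesis
        by (intro sum.cong refl arg_cong2[where f = "(*)"] idet_cong) auto
    qed
    also have "\<dots> = E Q"
      unfolding E_def \<theta>s_def
    proof (rule sum_idet_eq_J[OF carr(3,4) Q Q'(2)])
      show "det (principal_submat \<Psi> Q) \<noteq> 0"
        unfolding \<Psi>_def
        by (rule det_principal_submat_gram_plus_scalar_nonzero[OF T _ _ Q]) (use pos in auto)
    qed
    finally show ?thesis .
  qed

  define D where "D w = det (1\<^sub>m Nr + complex_of_real c \<cdot>\<^sub>m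
                      (G (fst w) (snd w) * ctrans (G (fst w) (snd w))))" for w
  have D: "D w = idet {..<Nt} (\<lambda>i j. (if i = j then 1 else 0) +
      complex_of_real c * (\<Sum>r<Nr. cnj (g r i w) * g r j w))" for w
    unfolding D_def det_one_plus_gram[OF carr(5)]
    by (intro idet_cong) (simp add: G_eq)
  have "has_bochner_integral P D (\<Sum>Q\<in>Pow {..<Nt}. complex_of_real c ^ card Q * E Q)"
    unfolding D idet_identity_plus[OF finite_lessThan]
    by (intro has_bochner_integral_sum has_bochner_integral_mult_right EQ) auto
  then have "has_bochner_integral P (\<lambda>w. Re (D w)) (Re (\<Sum>Q\<in>Pow {..<Nt}. complex_of_real c ^ card Q * E Q))"
    by (simp only: has_bochner_integral_iff integrable_Re integral_Re)
  then have "(\<integral>\<^sup>+ w. ennreal (log 2 (Re (D w))) \<partial>P) \<le>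
      ennreal (log 2 (Re (\<Sum>Q\<in>Pow {..<Nt}. complex_of_real c ^ card Q * E Q)))"
  proof (rule P.nn_integral_log_le[rotated])
    show "1 \<le> Re (D w)" for w
      unfolding D by (rule Re_idet_identity_plus_gram_ge_1) (use pos in auto)
  qed simp
  \<comment> \<open>Subsets are grouped by their size \<open>t\<close>, as in the stated
    bound.\<close>
  also have "(\<Sum>Q\<in>Pow {..<Nt}. complex_of_real c ^ card Q * E Q) =
     (\<Sum>t\<le>Nt. \<Sum>Q\<in>{Q \<in> Pow {..<Nt}. card Q = t}. complex_of_real c ^ card Q * E Q)"
  proof (rule sum.group[symmetric])
    show "card ` Pow {..<Nt} \<subseteq> {..Nt}"
      using card_mono[of "{..<Nt}"] by auto
  qed auto
  also have "\<dots> = (\<Sum>t\<le>Nt. complex_of_real (c ^ t) * (\<Sum>Q\<in>{Q. Q \<subseteq> {..<Nt} \<and> card Q = t}.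
      det (principal_submat \<Psi> Q) * J (int Nr) (\<theta>s Q)
             * complex_of_real (fact (Nr - length (\<theta>s Q)) / fact (Nr - t))))"
    unfolding sum_distrib_left by (intro sum.cong refl) (auto simp: E_def)
  finally show ?thesis unfolding D_def P_def .
qed

text \<open>The instance of \<open>ris_capacity_bound\<close> at the line-of-sight matrices. The
  non-negative integral is a faithful expectation, since the argument of its logarithm is at least
  1.\<close>

theorem theorem1:
  fixes Nt Nr Mh Mv PT PR PH :: nat
    and dtl drl dhl dvl :: real
    and tg rg hg :: "nat \<Rightarrow> complex"
    and phA1 thA1 thD1 thA2 phD2 thD2 thA3 thD3 :: "nat \<Rightarrow> real"
    and phase :: "nat \<Rightarrow> real"
    and bt br bd LR NR LH NH \<rho> :: real
  assumes "Nt > 0" "Nr \<ge> Nt" "Mh > 0" "Mv > 0"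
    and "PT > 0" "PR > 0" "PH > 0"
    and "dtl > 0" "drl > 0" "dhl > 0" "dvl > 0"
    and "bt > 0" "br > 0" "bd > 0"
    and "LR \<ge> 0" "NR \<ge> 0" "LR + NR = 1"
    and "LH \<ge> 0" "NH > 0" "LH + NH = 1"
    and "\<rho> > 0"
  shows
   "(let M = Mh * Mv;
         T = LoS_T Mh Mv Nt dhl dvl dtl PT tg phA1 thA1 thD1;
         Rb = LoS_R Mh Mv Nr dhl dvl drl PR rg thA2 phD2 thD2;
         Hb = LoS_H Nr Nt drl dtl PH hg thA3 thD3;
         \<Phi> = ris_phase M phase;
         \<rho>b = \<rho> / real Nt;
         Gb = complex_of_real (sqrt (bt * br * LR)) \<cdot>\<^sub>m (Rb * \<Phi> * T)
              + complex_of_real (sqrt (bd * LH)) \<cdot>\<^sub>m Hb;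
         \<Psi> = complex_of_real (bt * br * NR) \<cdot>\<^sub>m (ctrans T * T)
              + complex_of_real (bd * NH) \<cdot>\<^sub>m (1\<^sub>m Nt);
         \<Sigma> = ctrans Gb * Gb;
         G = (\<lambda>wR wH.
               let R = complex_of_real (sqrt LR) \<cdot>\<^sub>m Rb + complex_of_real (sqrt NR) \<cdot>\<^sub>m to_mat Nr M wR;
                   H = complex_of_real (sqrt LH) \<cdot>\<^sub>m Hb + complex_of_real (sqrt NH) \<cdot>\<^sub>m to_mat Nr Nt wH
               in complex_of_real (sqrt (bt * br)) \<cdot>\<^sub>m (R * \<Phi> * T) + complex_of_real (sqrt bd) \<cdot>\<^sub>m H);
         C = (\<integral>\<^sup>+ w. ennreal (log 2 (Re (det (1\<^sub>m Nr + complex_of_real \<rho>b \<cdot>\<^sub>m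
                      (G (fst w) (snd w) * ctrans (G (fst w) (snd w)))))))
                \<partial>(cgauss_mat_measure Nr M \<Otimes>\<^sub>M cgauss_mat_measure Nr Nt));
         bound = (\<Sum>t\<le>Nt. complex_of_real (\<rho>b ^ t) *
                   (\<Sum>Q\<in>{Q. Q \<subseteq> {..<Nt} \<and> card Q = t}.
                      let \<theta>s = nonzero_eigvals (minv (principal_submat \<Psi> Q) * principal_submat \<Sigma> Q);
                          L = length \<theta>s
                      in det (principal_submat \<Psi> Q) * J (int Nr) \<theta>s
                         * complex_of_real (fact (Nr - L) / fact (Nr - t))))
     in C \<le> ennreal (log 2 (Re bound)))"
  unfolding Let_def
proof (rule ris_capacity_bound)
  show "LoS_T Mh Mv Nt dhl dvl dtl PT tg phA1 thA1 thD1 \<in> carrier_mat (Mh * Mv) Nt"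
    by (simp add: LoS_T_def)
  show "LoS_R Mh Mv Nr dhl dvl drl PR rg thA2 phD2 thD2 \<in> carrier_mat Nr (Mh * Mv)"
    by (simp add: LoS_R_def)
  show "LoS_H Nr Nt drl dtl PH hg thA3 thD3 \<in> carrier_mat Nr Nt"
    by (simp add: LoS_H_def)
qed (use assms in auto)

end
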